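(* Let $R$ be an underlying ring, let $B$ be an $n\times n$ exchange matrix, and let $\tilde B$ be an extended exchange matrix with exchange matrix $B$ whose coefficient rows $(\mathbf b_i:i\in I)$ have entries in $R$. Then $\tilde B$ is universal over $R$ if and only if the coefficient rows $(\mathbf b_i:i\in I)$ of $\tilde B$ are an $R$-basis for $B$.
   Context: **Basic conventions.** $[n]=\{1,\dots,n\}$; $[a]_+=\max(a,0)$; $\operatorname{sgn}(a)\in\{-1,0,1\}$ is the sign of $a$; $\mathbf{min}(\mathbf a,\mathbf 0)$ is the entrywise minimum of a vector with $0$. An *underlying ring* $R$ is either $\mathbb Z$ or a field with $\mathbb Q\subseteq R\subseteq\mathbb R$. An *exchange matrix* is an $n\times n$ integer matrix $B=(b_{ij})$ that is skew-symmetrizable: there are positive integers $d_i$ with $d_ib_{ij}=-d_jb_{ji}$ for all $i,j$. An *extended exchange matrix* $\tilde B$ (over $R$) is a matrix with rows indexed by $[n]\sqcup I$ ($I$ an arbitrary, possibly infinite, index set) and columns indexed by $[n]$, with entries in $R$, whose rows indexed by $[n]$ form an exchange matrix $B$; the rows $\mathbf b_i=(b_{i1},\dots,b_{in})$, $i\in I$, are its *coefficient rows*. For $k\in[n]$, the mutation $\mu_k(\tilde B)=\tilde B'$ has $b'_{ij}=-b_{ij}$ if $i=k$ or $j=k$, and $b'_{ij}=b_{ij}+\operatorname{sgn}(b_{kj})[b_{ik}b_{kj}]_+$ otherwise (the same formula defines $\mu_k(B)$). **Tropical semifields.** $\mathbb P=\mathrm{Trop}_R(u_i:i\in I)$ is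 the multiplicative abelian group of formal products $\prod_{i\in I}u_i^{a_i}$, $a_i\in R$, with exponents adding under multiplication, with unit $1$, and auxiliary addition $\prod u_i^{a_i}\oplus\prod u_i^{b_i}=\prod u_i^{\min(a_i,b_i)}$. It is an $R$-module, $c\in R$ acting by $\prod u_i^{a_i}\mapsto\prod u_i^{ca_i}$, and carries the product topology, each factor $R$ being discrete. $\mathbb Z\mathbb P$, $\mathbb Q\mathbb P$ are the group rings of the multiplicative group $\mathbb P$. **Seeds and cluster algebras.** Let $\mathbb K$ be a field isomorphic to the field of rational functions in $n$ variables with coefficients in $\mathbb Q\mathbb P$. A (labeled geometric) seed is a pair $(\mathbf x,\tilde B)$ with $\tilde B$ an extended exchange matrix over $R$ with coefficient rows indexed by $I$ and $\mathbf x=(x_1,\dots,x_n)$ algebraically independent elements generating $\mathbb K$. Its coefficients are $y_j=\prod_{i\in I}u_i^{b_{ij}}$. The mutation $\mu_k(\mathbf x,\tilde B)=(\mathbf x',\mu_k(\tilde B))$ has $x'_j=x_j$ for $j\ne k$ and $$x'_k=\frac{y_k\prod_{i=1}^nx_i^{[b_{ik}]_+}+\prod_{i=1}^nx_i^{[-b_{ik}]_+}}{x_k(y_k\oplus1)}.$$ $\mathbb T_n$ is the $n$-regular tree with edges labeled by $[n]$, each vertex being incident to exactly one edge of each label; $t_0$ is a fixed vertex. Given a seed $(\mathbf x,\tilde B)$, the cluster pattern assigns to each vertex $t$ a seed $(\mathbf x_t,\tilde B_t)$, with $(\mathbf x_{t_0},\tilde B_{t_0})=(\mathbf x,\tilde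 B)$ and $(\mathbf x_{t'},\tilde B_{t'})=\mu_k(\mathbf x_t,\tilde B_t)$ when $t,t'$ are joined by an edge labeled $k$. Write $x_{j;t}$ and $y_{j;t}$ for the cluster variables and coefficients of the seed at $t$. The cluster algebra $\mathcal A_R(\mathbf x,\tilde B)$ (also $\mathcal A_R(\tilde B)$) is the $\mathbb Z\mathbb P$-subalgebra of $\mathbb K$ generated by all $x_{j;t}$. **Coefficient specialization and universality.** Let $(\mathbf x,\tilde B)$, $(\mathbf x',\tilde B')$ be seeds of rank $n$ with tropical semifields $\mathbb P,\mathbb P'$ over the same $R$. A ring homomorphism $\varphi:\mathcal A_R(\mathbf x,\tilde B)\to\mathcal A_R(\mathbf x',\tilde B')$ is a *coefficient specialization* if (i) the exchange matrices $B$ and $B'$ coincide; (ii) $\varphi(x_j)=x'_j$ for all $j$; (iii) the restriction of $\varphi$ to $\mathbb P$ is a continuous $R$-linear map to $\mathbb P'$ with $\varphi(y_{j;t})=y'_{j;t}$ and $\varphi(y_{j;t}\oplus1)=y'_{j;t}\oplus1$ for all $j\in[n]$, $t\in\mathbb T_n$. $\tilde B$ is *universal over $R$* if for every extended exchange matrix $\tilde B'$ over $R$ with the same exchange matrix $B$ (and any index set for the coefficient rows) there is a unique coefficient specialization $\mathcal A_R(\tilde B)\to\mathcal A_R(\tilde B')$. **Mutation maps.** For $k\in[n]$, $\eta_k^B:\mathbb R^n\to\mathbb R^n$ sends $\mathbf a$ to $\mathbf a'$, where $a'_k=-a_k$ and, for $j\ne k$: $a'_j=a_j+a_kb_{kj}$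 if $a_k\ge0$ and $b_{kj}\ge0$; $a'_j=a_j-a_kb_{kj}$ if $a_k\le0$ and $b_{kj}\le0$; $a'_j=a_j$ otherwise. For a finite sequence $\mathbf k=k_q,\dots,k_1$ in $[n]$, put $B_1=B$, $B_{i+1}=\mu_{k_i}(B_i)$ and $\eta^B_{\mathbf k}=\eta^{B_q}_{k_q}\circ\cdots\circ\eta^{B_1}_{k_1}$ (the identity if $\mathbf k$ is empty). **$B$-coherence and bases.** For $S$ finite, $\mathbf v_i\in\mathbb R^n$ and $c_i\in R$ ($i\in S$), the formal expression $\sum_{i\in S}c_i\mathbf v_i$ is a *$B$-coherent linear relation with coefficients in $R$* if $\sum_{i\in S}c_i\eta^B_{\mathbf k}(\mathbf v_i)=\mathbf 0$ and $\sum_{i\in S}c_i\,\mathbf{min}(\eta^B_{\mathbf k}(\mathbf v_i),\mathbf 0)=\mathbf 0$ for every finite sequence $\mathbf k$ in $[n]$. A collection $(\mathbf b_i:i\in I)$ of vectors in $R^n$ is an *$R$-basis for $B$* if (i) for every $\mathbf a\in R^n$ there are a finite $S\subseteq I$ and $c_i\in R$ ($i\in S$) such that $\mathbf a-\sum_{i\in S}c_i\mathbf b_i$ is a $B$-coherent linear relation; and (ii) if $S\subseteq I$ is finite and $\sum_{i\in S}c_i\mathbf b_i$ is a $B$-coherent linear relation with coefficients in $R$, then all $c_i=0$. *)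

theory Defs
  imports
    "HOL-Analysis.Analysis"
    "HOL-Library.Poly_Mapping"
    "HOL-Computational_Algebra.Fraction_Field"
begin

section \<open>Subrings, subfields, underlying rings\<close>

definition is_subring :: "'a::ring_1 set \<Rightarrow> bool" where
  "is_subring A \<longleftrightarrow> 1 \<in> A \<and> (\<forall>a\<in>A. \<forall>b\<in>A. a - b \<in> A \<and> a * b \<in> A)"

definition is_subfield :: "'a::field set \<Rightarrow> bool" where
  "is_subfield A \<longleftrightarrow> is_subring A \<and> (\<forall>a\<in>A. inverse a \<in> A)"

definition underlying_ring :: "real set \<Rightarrow> bool" where
  "underlying_ring R \<longleftrightarrow> R = \<int> \<or> (\<rat> \<subseteq> R \<and> is_subfield R)"


section \<open>Extended exchange matrices and their mutation\<close>

text \<open>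
  An extended exchange matrix is a pair: its rows indexed by \<open>[n]\<close> (the exchange matrix, with
  integer entries) and its coefficient rows, indexed by \<open>I :: 'i set\<close>.  Throughout,
  \<open>[n]\<close> is \<open>{1..n}\<close>, and entries at indices outside \<open>[n]\<close> and \<open>I\<close> are junk that no notion
  below depends on.
\<close>

type_synonym 'i ext_matrix = "(nat \<Rightarrow> nat \<Rightarrow> int) \<times> ('i \<Rightarrow> nat \<Rightarrow> real)"

definition exchange_matrix :: "nat \<Rightarrow> (nat \<Rightarrow> nat \<Rightarrow> int) \<Rightarrow> bool" where
  "exchange_matrix n B \<longleftrightarrow>
     (\<exists>d :: nat \<Rightarrow> int. (\<forall>i\<in>{1..n}. d i > 0) \<and>
        (\<forall>i\<in>{1..n}. \<forall>j\<in>{1..n}. d i * B i j = - d j * B j i))"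

definition extended_exchange_matrix :: "real set \<Rightarrow> nat \<Rightarrow> 'i set \<Rightarrow> 'i ext_matrix \<Rightarrow> bool" where
  "extended_exchange_matrix R n I Bt \<longleftrightarrow>
     exchange_matrix n (fst Bt) \<and> (\<forall>i\<in>I. \<forall>j\<in>{1..n}. snd Bt i j \<in> R)"

definition mutate :: "nat \<Rightarrow> (nat \<Rightarrow> nat \<Rightarrow> int) \<Rightarrow> nat \<Rightarrow> nat \<Rightarrow> int" where
  "mutate k B = (\<lambda>i j. if i = k \<or> j = k then - B i j
                       else B i j + sgn (B k j) * max (B i k * B k j) 0)"

text \<open>The row index \<open>k\<close> always lies in \<open>[n]\<close>, hence is never the index of a coefficient row.\<close>

definition mutate_ext :: "nat \<Rightarrow> 'i ext_matrix \<Rightarrow> 'i ext_matrix" where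
  "mutate_ext k Bt = (case Bt of (B, C) \<Rightarrow>
     (mutate k B,
      \<lambda>i j. if j = k then - C i j
            else C i j + of_int (sgn (B k j)) * max (C i k * of_int (B k j)) 0))"


section \<open>Tropical semifields\<close>

text \<open>
  \<open>Trop a\<close> is the formal product of the \<open>u\<^sub>i\<close> with exponents \<open>a i\<close>.  The group of these formal
  products is written additively here, so that \<open>'i trop \<Rightarrow>\<^sub>0 rat\<close> (finitely supported
  functions with convolution product) is its group ring: \<open>+\<close> on \<open>'i trop\<close> is the
  multiplication of the tropical semifield and \<open>0\<close> is its unit.
\<close>

datatype 'i trop = Trop (expo: "'i \<Rightarrow> real")

text \<open>
  The linear order on \<open>'i trop\<close> is lexicographic with respect to an arbitrary well-order of the
  indices.  Its only purpose is to make the group ring an integral domain via the type class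
  instance for \<open>poly_mapping\<close>, so that fields of fractions can be formed.
\<close>

definition index_order :: "'i rel" where
  "index_order = (SOME r. wf r \<and> total r \<and> trans r)"

lemma index_order: "wf (index_order :: 'i rel)" "total (index_order :: 'i rel)"
  "trans (index_order :: 'i rel)"
proof -
  obtain r :: "'i rel" where r: "Well_order r" "Field r = UNIV"
    using well_ordering by metis
  have 1: "wf (r - Id)" using r(1) unfolding well_order_on_def by (rule conjunct2)
  have 2: "total (r - Id)" using r unfolding well_order_on_def linear_order_on_def
    by (metis total_on_diff_Id)
  have 3: "trans (r - Id)" using r
    unfolding well_order_on_def linear_order_on_def partial_order_on_def preorder_on_def
    by (metis trans_diff_Id)
  have "\<exists>r :: 'i rel. wf r \<and> total r \<and> trans r" using 1 2 3 by metis
  then have *: "wf (index_order :: 'i rel) \<and> total (index_order :: 'i rel) \<and> trans (index_order :: 'i rel)"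
    unfolding index_order_def by (rule someI_ex)
  show "wf (index_order :: 'i rel)" using * by (rule conjunct1)
  show "total (index_order :: 'i rel)" using * by (metis (no_types))
  show "trans (index_order :: 'i rel)" using * by (metis (no_types))
qed

instantiation trop :: (type) linordered_ab_group_add
begin

definition zero_trop :: "'a trop" where "0 = Trop (\<lambda>_. 0)"
definition plus_trop :: "'a trop \<Rightarrow> 'a trop \<Rightarrow> 'a trop" where
  "p + q = Trop (\<lambda>i. expo p i + expo q i)"
definition uminus_trop :: "'a trop \<Rightarrow> 'a trop" where
  "- p = Trop (\<lambda>i. - expo p i)"
definition minus_trop :: "'a trop \<Rightarrow> 'a trop \<Rightarrow> 'a trop" where
  "p - q = Trop (\<lambda>i. expo p i - expo q i)"
definition less_trop :: "'a trop \<Rightarrow> 'a trop \<Rightarrow> bool" where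
  "p < q \<longleftrightarrow> (\<exists>i. expo p i < expo q i \<and> (\<forall>j. (j, i) \<in> index_order \<longrightarrow> expo p j = expo q j))"
definition less_eq_trop :: "'a trop \<Rightarrow> 'a trop \<Rightarrow> bool" where
  "p \<le> q \<longleftrightarrow> p = q \<or> p < (q :: 'a trop)"

instance
proof
  fix a b c :: "'a trop"
  have tot: "i = j \<or> (i, j) \<in> index_order \<or> (j, i) \<in> index_order" for i j :: 'a
    using index_order(2) by (auto simp: total_on_def)
  have tr: "(i, j) \<in> index_order \<Longrightarrow> (j, k) \<in> index_order \<Longrightarrow> (i, k) \<in> index_order" for i j k :: 'a
    using index_order(3) by (meson transD)
  have trans: "p < r" if "p < q" "q < r" for p q r :: "'a trop"
  proof -
    obtain i where i: "expo p i < expo q i" "\<And>j. (j, i) \<in> index_order \<Longrightarrow> expo p j = expo q j"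
      using \<open>p < q\<close> by (auto simp: less_trop_def)
    obtain k where k: "expo q k < expo r k" "\<And>j. (j, k) \<in> index_order \<Longrightarrow> expo q j = expo r j"
      using \<open>q < r\<close> by (auto simp: less_trop_def)
    consider "i = k" | "(i, k) \<in> index_order" | "(k, i) \<in> index_order" using tot by blast
    then show ?thesis
    proof cases
      case 1
      then show ?thesis unfolding less_trop_def using i k by (intro exI[of _ i]) auto
    next
      case 2
      then have "expo q i = expo r i" using k(2) by blast
      moreover have "expo p j = expo r j" if "(j, i) \<in> index_order" for j
        using that 2 i(2) k(2) tr by metis
      ultimately show ?thesis unfolding less_trop_def using i(1) by (intro exI[of _ i]) auto
    next
      case 3
      then have "expo p k = expo q k" using i(2) by blast
      moreover have "expo p j = expo r j" if "(j, k) \<in> index_order" for j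
        using that 3 i(2) k(2) tr by metis
      ultimately show ?thesis unfolding less_trop_def using k(1) by (intro exI[of _ k]) auto
    qed
  qed
  have irr: "\<not> p < p" for p :: "'a trop" by (auto simp: less_trop_def)
  show "a + b + c = a + (b + c)" "a + b = b + a" "0 + a = a" "- a + a = 0" "a - b = a + - b"
    by (simp_all add: plus_trop_def zero_trop_def uminus_trop_def minus_trop_def algebra_simps)
  show "(a < b) = (a \<le> b \<and> \<not> b \<le> a)"
    unfolding less_eq_trop_def using trans irr by metis
  show "a \<le> a" by (simp add: less_eq_trop_def)
  show "a \<le> b \<Longrightarrow> b \<le> c \<Longrightarrow> a \<le> c" unfolding less_eq_trop_def using trans by metis
  show "a \<le> b \<Longrightarrow> b \<le> a \<Longrightarrow> a = b" unfolding less_eq_trop_def using trans irr by metis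
  show "a \<le> b \<Longrightarrow> c + a \<le> c + b" by (auto simp: less_eq_trop_def less_trop_def plus_trop_def)
  show "a \<le> b \<or> b \<le> a"
  proof (cases "a = b")
    case False
    then obtain i0 where i0: "i0 \<in> {i. expo a i \<noteq> expo b i}"
      using trop.expand[of a b] by (auto simp: fun_eq_iff)
    obtain i where i: "i \<in> {i. expo a i \<noteq> expo b i}"
      "\<And>j. (j, i) \<in> index_order \<Longrightarrow> j \<notin> {i. expo a i \<noteq> expo b i}"
      using wfE_min[OF index_order(1) i0] by blast
    then consider "expo a i < expo b i" | "expo b i < expo a i" by fastforce
    then have "a < b \<or> b < a"
    proof cases
      case 1
      then have "a < b" unfolding less_trop_def using i(2) by (intro exI[of _ i]) simp
      then show ?thesis ..
    next
      case 2
      then have "b < a" unfolding less_trop_def using i(2) by (intro exI[of _ i]) simp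
      then show ?thesis ..
    qed
    then show ?thesis by (auto simp: less_eq_trop_def)
  qed (simp add: less_eq_trop_def)
qed

end

definition trop_group :: "real set \<Rightarrow> 'i set \<Rightarrow> 'i trop set" where
  "trop_group R I = {p. (\<forall>i\<in>I. expo p i \<in> R) \<and> (\<forall>i. i \<notin> I \<longrightarrow> expo p i = 0)}"

definition trop_oplus :: "'i trop \<Rightarrow> 'i trop \<Rightarrow> 'i trop" where
  "trop_oplus p q = Trop (\<lambda>i. min (expo p i) (expo q i))"

definition trop_scale :: "real \<Rightarrow> 'i trop \<Rightarrow> 'i trop" where
  "trop_scale c p = Trop (\<lambda>i. c * expo p i)"

definition trop_topology :: "real set \<Rightarrow> 'i set \<Rightarrow> 'i trop topology" where
  "trop_topology R I =
     pullback_topology (trop_group R I) (\<lambda>p. restrict (expo p) I)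
       (product_topology (\<lambda>_. discrete_topology R) I)"


section \<open>The ambient field\<close>

text \<open>
  Polynomials over the group ring in countably many variables are finitely supported functions
  from monomials \<open>nat \<Rightarrow>\<^sub>0 nat\<close>; \<open>'i ratfun\<close> is their field of fractions.  The ambient field
  for \<open>R\<close>, \<open>I\<close>, \<open>n\<close> is the subfield of fractions of polynomials involving only the variables
  with index in \<open>[n]\<close> and only coefficients from the group ring of \<open>trop_group R I\<close>.
\<close>

type_synonym 'i poly_ring = "(nat \<Rightarrow>\<^sub>0 nat) \<Rightarrow>\<^sub>0 ('i trop \<Rightarrow>\<^sub>0 rat)"
type_synonym 'i ratfun = "'i poly_ring fract"

definition group_ring_Q :: "real set \<Rightarrow> 'i set \<Rightarrow> ('i trop \<Rightarrow>\<^sub>0 rat) set" where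
  "group_ring_Q R I = {a. Poly_Mapping.keys a \<subseteq> trop_group R I}"

definition group_ring_Z :: "real set \<Rightarrow> 'i set \<Rightarrow> ('i trop \<Rightarrow>\<^sub>0 rat) set" where
  "group_ring_Z R I = {a \<in> group_ring_Q R I. \<forall>p. Poly_Mapping.lookup a p \<in> \<int>}"

definition polys :: "real set \<Rightarrow> 'i set \<Rightarrow> nat \<Rightarrow> 'i poly_ring set" where
  "polys R I n = {f. (\<forall>m\<in>Poly_Mapping.keys f. Poly_Mapping.keys m \<subseteq> {1..n}) \<and>
                     (\<forall>m. Poly_Mapping.lookup f m \<in> group_ring_Q R I)}"

definition ambient_field :: "real set \<Rightarrow> 'i set \<Rightarrow> nat \<Rightarrow> 'i ratfun set" where
  "ambient_field R I n = {Fract f g | f g. f \<in> polys R I n \<and> g \<in> polys R I n \<and> g \<noteq> 0}"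

definition const :: "('i trop \<Rightarrow>\<^sub>0 rat) \<Rightarrow> 'i ratfun" where
  "const a = Fract (Poly_Mapping.single 0 a) 1"

definition trop_emb :: "'i trop \<Rightarrow> 'i ratfun" where
  "trop_emb p = const (Poly_Mapping.single p 1)"

definition poly_eval :: "(nat \<Rightarrow> 'i ratfun) \<Rightarrow> 'i poly_ring \<Rightarrow> 'i ratfun" where
  "poly_eval x f = (\<Sum>m\<in>Poly_Mapping.keys f. const (Poly_Mapping.lookup f m) *
                      (\<Prod>j\<in>Poly_Mapping.keys m. x j ^ Poly_Mapping.lookup m j))"


section \<open>Seeds and cluster algebras\<close>

type_synonym 'i seed = "(nat \<Rightarrow> 'i ratfun) \<times> 'i ext_matrix"

definition is_seed :: "real set \<Rightarrow> nat \<Rightarrow> 'i set \<Rightarrow> 'i seed \<Rightarrow> bool" where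
  "is_seed R n I \<Sigma> \<longleftrightarrow> (case \<Sigma> of (x, Bt) \<Rightarrow>
     extended_exchange_matrix R n I Bt \<and>
     x ` {1..n} \<subseteq> ambient_field R I n \<and>
     (\<forall>f\<in>polys R I n. poly_eval x f = 0 \<longrightarrow> f = 0) \<and>
     is_subfield hull (const ` group_ring_Q R I \<union> x ` {1..n}) = ambient_field R I n)"

definition coeff :: "'i set \<Rightarrow> 'i ext_matrix \<Rightarrow> nat \<Rightarrow> 'i trop" where
  "coeff I Bt j = Trop (\<lambda>i. if i \<in> I then snd Bt i j else 0)"

definition mutate_seed :: "nat \<Rightarrow> 'i set \<Rightarrow> nat \<Rightarrow> 'i seed \<Rightarrow> 'i seed" where
  "mutate_seed n I k \<Sigma> = (case \<Sigma> of (x, Bt) \<Rightarrow>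
     (x(k := (trop_emb (coeff I Bt k) * (\<Prod>i\<in>{1..n}. x i ^ nat (max (fst Bt i k) 0)) +
              (\<Prod>i\<in>{1..n}. x i ^ nat (max (- fst Bt i k) 0))) /
             (x k * trop_emb (trop_oplus (coeff I Bt k) 0))),
      mutate_ext k Bt))"

text \<open>
  The tree \<open>\<TT>\<^sub>n\<close>: its vertices are the words over \<open>[n]\<close> without two equal adjacent
  letters, \<open>t\<^sub>0\<close> is the empty word, and an edge labeled \<open>k\<close> joins \<open>t\<close> and \<open>k # t\<close>.  As
  seed mutation is an involution, the cluster pattern is determined by recursion along the words.
\<close>

definition tree_vertices :: "nat \<Rightarrow> nat list set" where
  "tree_vertices n = {t. set t \<subseteq> {1..n} \<and> distinct_adj t}"

primrec seed_at :: "nat \<Rightarrow> 'i set \<Rightarrow> 'i seed \<Rightarrow> nat list \<Rightarrow> 'i seed" where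
  "seed_at n I \<Sigma> [] = \<Sigma>"
| "seed_at n I \<Sigma> (k # t) = mutate_seed n I k (seed_at n I \<Sigma> t)"

definition cluster_var :: "nat \<Rightarrow> 'i set \<Rightarrow> 'i seed \<Rightarrow> nat list \<Rightarrow> nat \<Rightarrow> 'i ratfun" where
  "cluster_var n I \<Sigma> t j = fst (seed_at n I \<Sigma> t) j"

definition coeff_at :: "nat \<Rightarrow> 'i set \<Rightarrow> 'i seed \<Rightarrow> nat list \<Rightarrow> nat \<Rightarrow> 'i trop" where
  "coeff_at n I \<Sigma> t j = coeff I (snd (seed_at n I \<Sigma> t)) j"

definition cluster_algebra :: "real set \<Rightarrow> nat \<Rightarrow> 'i set \<Rightarrow> 'i seed \<Rightarrow> 'i ratfun set" where
  "cluster_algebra R n I \<Sigma> =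
     is_subring hull (const ` group_ring_Z R I \<union>
        {cluster_var n I \<Sigma> t j | t j. t \<in> tree_vertices n \<and> j \<in> {1..n}})"


section \<open>Seeds exist\<close>

text \<open>
  Every extended exchange matrix occurs in a seed, namely with the variables as cluster
  (\<open>is_seed_variable\<close>); so the quantification over seeds in \<open>universal\<close> below is not vacuous.
\<close>

definition variable :: "nat \<Rightarrow> 'i ratfun" where
  "variable j = Fract (Poly_Mapping.single (Poly_Mapping.single j 1) 1) 1"

lemma Fract_prod: "(\<Prod>i\<in>A. Fract (f i) 1) = Fract (\<Prod>i\<in>A. f i) 1"
  for f :: "'b \<Rightarrow> 'a::idom"
  by (induction A rule: infinite_finite_induct) (auto simp: One_fract_def)
lemma Fract_sum: "(\<Sum>i\<in>A. Fract (f i) 1) = Fract (\<Sum>i\<in>A. f i) 1"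
  for f :: "'b \<Rightarrow> 'a::idom"
  by (induction A rule: infinite_finite_induct) (auto simp: Zero_fract_def)
lemma Fract_pow: "Fract a 1 ^ k = Fract (a ^ k) (1::'a::idom)"
  by (induction k) (auto simp: One_fract_def)
lemma single_pow: "Poly_Mapping.single m (1::'b::comm_ring_1) ^ k = Poly_Mapping.single (\<Sum>i<k. m) 1"
  for m :: "'a::comm_monoid_add"
  by (induction k) (auto simp: mult_single add.commute single_one)
lemma single_prod: "(\<Prod>j\<in>A. Poly_Mapping.single (m j) (1::'b::comm_ring_1)) = Poly_Mapping.single (\<Sum>j\<in>A. m j) 1"
  for m :: "'c \<Rightarrow> 'a::comm_monoid_add"
  by (induction A rule: infinite_finite_induct) (auto simp: mult_single single_one)
lemma sum_monos: "(\<Sum>m\<in>Poly_Mapping.keys f. Poly_Mapping.single m (Poly_Mapping.lookup f m)) = f"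
  for f :: "'a \<Rightarrow>\<^sub>0 'b::comm_monoid_add"
  by (rule poly_mapping_eqI)
     (simp add: lookup_sum lookup_single when_def in_keys_iff sum.If_cases)
lemma sum_const_single: "(\<Sum>i<k. Poly_Mapping.single j (Suc 0)) = Poly_Mapping.single j k"
  by (induction k) (auto simp: single_add[symmetric] simp del: sum_constant)

lemma poly_eval_variable: "poly_eval variable f = Fract f 1"
proof -
  have "const (Poly_Mapping.lookup f m) * (\<Prod>j\<in>Poly_Mapping.keys m. variable j ^ Poly_Mapping.lookup m j)
     = Fract (Poly_Mapping.single m (Poly_Mapping.lookup f m)) 1" for m
    by (simp add: const_def variable_def Fract_pow Fract_prod single_pow single_prod mult_single
        sum_const_single sum_monos del: sum_constant)
  then show ?thesis unfolding poly_eval_def by (simp add: Fract_sum sum_monos)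
qed

lemma trop_group_add: "underlying_ring R \<Longrightarrow> p \<in> trop_group R I \<Longrightarrow> q \<in> trop_group R I \<Longrightarrow> p + q \<in> trop_group R I"
proof -
  assume R: "underlying_ring R" and p: "p \<in> trop_group R I" "q \<in> trop_group R I"
  have "a + b \<in> R" if "a \<in> R" "b \<in> R" for a b
  proof (cases "R = \<int>")
    case False
    then have s: "\<And>a b. a \<in> R \<Longrightarrow> b \<in> R \<Longrightarrow> a - b \<in> R" "0 \<in> R"
      using R by (auto simp: underlying_ring_def is_subfield_def is_subring_def)
    have "a - (0 - b) \<in> R" using that s by blast
    then show ?thesis by simp
  qed (use that in auto)
  then show ?thesis using p by (auto simp: trop_group_def plus_trop_def)
qed
lemma trop_group_0: "underlying_ring R \<Longrightarrow> 0 \<in> trop_group R I"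
  by (auto simp: trop_group_def zero_trop_def underlying_ring_def)

context fixes R :: "real set" assumes R: "underlying_ring R" begin

lemma gr_mult: "a \<in> group_ring_Q R I \<Longrightarrow> b \<in> group_ring_Q R I \<Longrightarrow> a * b \<in> group_ring_Q R I"
  unfolding group_ring_Q_def using keys_mult[of a b] trop_group_add[OF R] by blast
lemma gr_add: "a \<in> group_ring_Q R I \<Longrightarrow> b \<in> group_ring_Q R I \<Longrightarrow> a + b \<in> group_ring_Q R I"
  unfolding group_ring_Q_def using keys_add[of a b] by blast
lemma gr_uminus: "a \<in> group_ring_Q R I \<Longrightarrow> - a \<in> group_ring_Q R I"
  unfolding group_ring_Q_def by simp
lemma gr_0: "0 \<in> group_ring_Q R I"
  unfolding group_ring_Q_def by simp
lemma gr_1: "1 \<in> group_ring_Q R I"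
  unfolding group_ring_Q_def using trop_group_0[OF R] by simp

lemma pol_add: "f \<in> polys R I n \<Longrightarrow> g \<in> polys R I n \<Longrightarrow> f + g \<in> polys R I n"
  unfolding polys_def mem_Collect_eq lookup_add using keys_add[of f g] gr_add by (meson UnE subset_iff)
lemma pol_uminus: "f \<in> polys R I n \<Longrightarrow> - f \<in> polys R I n"
  unfolding polys_def by (auto simp: lookup_uminus gr_uminus)
lemma pol_0: "0 \<in> polys R I n"
  unfolding polys_def by (auto simp: gr_0)
lemma pol_sum: "(\<And>i. i \<in> A \<Longrightarrow> h i \<in> polys R I n) \<Longrightarrow> (\<Sum>i\<in>A. h i) \<in> polys R I n"
  by (induction A rule: infinite_finite_induct) (auto simp: pol_0 pol_add)
lemma pol_single: "Poly_Mapping.keys m \<subseteq> {1..n} \<Longrightarrow> a \<in> group_ring_Q R I \<Longrightarrow> Poly_Mapping.single m a \<in> polys R I n"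
  unfolding polys_def by (auto simp: lookup_single when_def gr_0)
lemma pol_mult: assumes "f \<in> polys R I n" "g \<in> polys R I n" shows "f * g \<in> polys R I n"
proof -
  have "f * g = (\<Sum>m\<in>Poly_Mapping.keys f. Poly_Mapping.single m (Poly_Mapping.lookup f m)) *
     (\<Sum>m\<in>Poly_Mapping.keys g. Poly_Mapping.single m (Poly_Mapping.lookup g m))"
    by (simp add: sum_monos)
  also have "\<dots> = (\<Sum>m\<in>Poly_Mapping.keys f. \<Sum>k\<in>Poly_Mapping.keys g.
      Poly_Mapping.single (m + k) (Poly_Mapping.lookup f m * Poly_Mapping.lookup g k))"
    by (simp add: sum_product mult_single)
  also have "\<dots> \<in> polys R I n"
  proof (intro pol_sum pol_single gr_mult)
    fix m k assume "m \<in> Poly_Mapping.keys f" "k \<in> Poly_Mapping.keys g"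
    then show "Poly_Mapping.keys (m + k) \<subseteq> {1..n}"
      using assms keys_add[of m k] unfolding polys_def by blast
  qed (use assms in \<open>auto simp: polys_def\<close>)
  finally show ?thesis .
qed
lemma pol_1: "1 \<in> polys R I n"
  using pol_single[of 0 n 1 I] gr_1[of I] by (simp add: single_one)

lemma ambI: "f \<in> polys R I n \<Longrightarrow> g \<in> polys R I n \<Longrightarrow> g \<noteq> 0 \<Longrightarrow> Fract f g \<in> ambient_field R I n"
  unfolding ambient_field_def by blast

lemma subfield_ambient: "is_subfield (ambient_field R I n)"
  unfolding is_subfield_def is_subring_def
proof (intro conjI ballI)
  show "1 \<in> ambient_field R I n"
    unfolding One_fract_def by (intro ambI pol_1) simp
next
  fix a b assume "a \<in> ambient_field R I n" "b \<in> ambient_field R I n"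
  then obtain f g f' g' where *: "a = Fract f g" "b = Fract f' g'" "g \<noteq> 0" "g' \<noteq> 0"
    "f \<in> polys R I n" "g \<in> polys R I n" "f' \<in> polys R I n" "g' \<in> polys R I n"
    unfolding ambient_field_def by blast
  have 1: "a - b = Fract (f * g' + - (f' * g)) (g * g')" using * by simp
  show "a - b \<in> ambient_field R I n"
    unfolding 1 using * by (auto intro!: ambI pol_add pol_uminus pol_mult simp del: add_uminus_conv_diff)
  have 2: "a * b = Fract (f * f') (g * g')" using * by simp
  show "a * b \<in> ambient_field R I n"
    unfolding 2 using * by (auto intro!: ambI pol_mult)
next
  fix a assume "a \<in> ambient_field R I n"
  then obtain f g where *: "a = Fract f g" "g \<noteq> 0" "f \<in> polys R I n" "g \<in> polys R I n"
    unfolding ambient_field_def by blast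
  show "inverse a \<in> ambient_field R I n"
  proof (cases "f = 0")
    case True
    then have "inverse a = Fract 0 1" using * by (simp add: Zero_fract_def[symmetric] fract_collapse)
    then show ?thesis by (auto intro!: ambI pol_0 pol_1)
  next
    case False
    have "inverse a = Fract g f" using * by simp
    then show ?thesis using * False by (auto intro: ambI)
  qed
qed

lemma is_seed_variable:
  assumes "extended_exchange_matrix R n I Bt"
  shows "is_seed R n I (variable, Bt)"
proof -
  have amb: "Fract f 1 \<in> ambient_field R I n" if "f \<in> polys R I n" for f
    by (intro ambI pol_1 that) simp
  have 1: "variable ` {1..n} \<subseteq> ambient_field R I n"
    unfolding variable_def using gr_1 by (auto intro!: amb pol_single)
  have 2: "const ` group_ring_Q R I \<subseteq> ambient_field R I n"
    unfolding const_def by (auto intro!: amb pol_single)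
  have 3: "f = 0" if "poly_eval variable f = 0" for f :: "'a poly_ring"
    using that by (simp add: poly_eval_variable Zero_fract_def eq_fract)
  have "is_subfield hull (const ` group_ring_Q R I \<union> variable ` {1..n}) = ambient_field R I n"
  proof (rule hull_unique)
    fix T assume T: "const ` group_ring_Q R I \<union> variable ` {1..n} \<subseteq> T" "is_subfield T"
    have s: "1 \<in> T" "\<And>a b. a \<in> T \<Longrightarrow> b \<in> T \<Longrightarrow> a - b \<in> T" "\<And>a b. a \<in> T \<Longrightarrow> b \<in> T \<Longrightarrow> a * b \<in> T"
      "\<And>a. a \<in> T \<Longrightarrow> inverse a \<in> T"
      using T(2) by (auto simp: is_subfield_def is_subring_def)
    have z: "0 \<in> T" using s(2)[OF s(1) s(1)] by simp
    have a: "a + b \<in> T" if "a \<in> T" "b \<in> T" for a b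
      using s(2)[OF that(1) s(2)[OF z that(2)]] by simp
    have sm: "(\<And>i. i \<in> A \<Longrightarrow> h i \<in> T) \<Longrightarrow> (\<Sum>i\<in>A. h i) \<in> T" for A :: "(nat \<Rightarrow>\<^sub>0 nat) set" and h
      by (induction A rule: infinite_finite_induct) (auto simp: z a)
    have pm: "(\<And>i. i \<in> A \<Longrightarrow> h i \<in> T) \<Longrightarrow> (\<Prod>i\<in>A. h i) \<in> T" for A :: "nat set" and h
      by (induction A rule: infinite_finite_induct) (auto simp: s)
    have pw: "b \<in> T \<Longrightarrow> b ^ k \<in> T" for b k by (induction k) (auto simp: s)
    have P: "Fract f 1 \<in> T" if f: "f \<in> polys R I n" for f
    proof -
      have "poly_eval variable f \<in> T"
        unfolding poly_eval_def
      proof (intro sm s(3) pm pw)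
        fix m assume "m \<in> Poly_Mapping.keys f"
        then show "const (poly_mapping.lookup f m) \<in> T" using f T(1) by (auto simp: polys_def)
        fix i assume "i \<in> Poly_Mapping.keys m"
        with \<open>m \<in> Poly_Mapping.keys f\<close> show "variable i \<in> T" using f T(1) unfolding polys_def by blast
      qed
      then show ?thesis by (simp add: poly_eval_variable)
    qed
    show "ambient_field R I n \<subseteq> T"
    proof
      fix a assume "a \<in> ambient_field R I n"
      then obtain f g where *: "a = Fract f g" "f \<in> polys R I n" "g \<in> polys R I n"
        unfolding ambient_field_def by blast
      then have "a = Fract f 1 * inverse (Fract g 1)" by simp
      then show "a \<in> T" using P * s by metis
    qed
  qed (use 1 2 subfield_ambient in auto)
  then show ?thesis using assms 1 3 by (simp add: is_seed_def)
qed
end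


section \<open>Coefficient specialization and universality\<close>

definition same_exchange_matrix :: "nat \<Rightarrow> 'i ext_matrix \<Rightarrow> 'j ext_matrix \<Rightarrow> bool" where
  "same_exchange_matrix n Bt Bt' \<longleftrightarrow> (\<forall>i\<in>{1..n}. \<forall>j\<in>{1..n}. fst Bt i j = fst Bt' i j)"

definition ring_hom_on :: "'a::ring_1 set \<Rightarrow> 'b::ring_1 set \<Rightarrow> ('a \<Rightarrow> 'b) \<Rightarrow> bool" where
  "ring_hom_on A A' \<phi> \<longleftrightarrow> \<phi> \<in> A \<rightarrow> A' \<and> \<phi> 1 = 1 \<and>
     (\<forall>a\<in>A. \<forall>b\<in>A. \<phi> (a + b) = \<phi> a + \<phi> b \<and> \<phi> (a * b) = \<phi> a * \<phi> b)"

definition R_linear :: "real set \<Rightarrow> 'i set \<Rightarrow> ('i trop \<Rightarrow> 'j trop) \<Rightarrow> bool" where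
  "R_linear R I \<theta> \<longleftrightarrow>
     (\<forall>p\<in>trop_group R I. \<forall>q\<in>trop_group R I. \<theta> (p + q) = \<theta> p + \<theta> q) \<and>
     (\<forall>c\<in>R. \<forall>p\<in>trop_group R I. \<theta> (trop_scale c p) = trop_scale c (\<theta> p))"

text \<open>
  The map \<open>\<theta>\<close> is the restriction of \<open>\<phi>\<close> to the tropical semifield; it is unique on
  \<open>trop_group R I\<close> because \<open>trop_emb\<close> is injective.
\<close>

definition coefficient_specialization ::
  "real set \<Rightarrow> nat \<Rightarrow> 'i set \<Rightarrow> 'i seed \<Rightarrow> 'j set \<Rightarrow> 'j seed \<Rightarrow> ('i ratfun \<Rightarrow> 'j ratfun) \<Rightarrow> bool" where
  "coefficient_specialization R n I \<Sigma> J \<Sigma>' \<phi> \<longleftrightarrow>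
     ring_hom_on (cluster_algebra R n I \<Sigma>) (cluster_algebra R n J \<Sigma>') \<phi> \<and>
     same_exchange_matrix n (snd \<Sigma>) (snd \<Sigma>') \<and>
     (\<forall>j\<in>{1..n}. \<phi> (fst \<Sigma> j) = fst \<Sigma>' j) \<and>
     (\<exists>\<theta>. (\<forall>p\<in>trop_group R I. \<phi> (trop_emb p) = trop_emb (\<theta> p)) \<and>
          \<theta> \<in> trop_group R I \<rightarrow> trop_group R J \<and>
          R_linear R I \<theta> \<and>
          continuous_map (trop_topology R I) (trop_topology R J) \<theta>) \<and>
     (\<forall>t\<in>tree_vertices n. \<forall>j\<in>{1..n}.
        \<phi> (trop_emb (coeff_at n I \<Sigma> t j)) = trop_emb (coeff_at n J \<Sigma>' t j) \<and>
        \<phi> (trop_emb (trop_oplus (coeff_at n I \<Sigma> t j) 0)) =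
          trop_emb (trop_oplus (coeff_at n J \<Sigma>' t j) 0))"

text \<open>
  The type argument \<open>'j\<close> is the type from which the index sets \<open>J\<close> of the target matrices are
  taken; leaving it as a type variable in a theorem makes it arbitrary.  The cluster
  algebra of a matrix depends on the choice of the initial cluster only up to isomorphism, so
  all choices of initial clusters are quantified over.  Maps out of the cluster algebra are taken
  to be \<open>extensional\<close>, so that uniqueness means uniqueness on the cluster algebra.
\<close>

definition universal :: "'j itself \<Rightarrow> real set \<Rightarrow> nat \<Rightarrow> 'i set \<Rightarrow> 'i ext_matrix \<Rightarrow> bool" where
  "universal (_ :: 'j itself) R n I Bt \<longleftrightarrow>
     (\<forall>(J :: 'j set) Bt' x x'.
        extended_exchange_matrix R n J Bt' \<and> same_exchange_matrix n Bt Bt' \<and>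
        is_seed R n I (x, Bt) \<and> is_seed R n J (x', Bt') \<longrightarrow>
        (\<exists>!\<phi>. \<phi> \<in> extensional (cluster_algebra R n I (x, Bt)) \<and>
              coefficient_specialization R n I (x, Bt) J (x', Bt') \<phi>))"


section \<open>Mutation maps, coherent relations, bases\<close>

definition eta :: "(nat \<Rightarrow> nat \<Rightarrow> int) \<Rightarrow> nat \<Rightarrow> (nat \<Rightarrow> real) \<Rightarrow> nat \<Rightarrow> real" where
  "eta B k a = (\<lambda>j. if j = k then - a k
                    else if a k \<ge> 0 \<and> B k j \<ge> 0 then a j + a k * of_int (B k j)
                    else if a k \<le> 0 \<and> B k j \<le> 0 then a j - a k * of_int (B k j)
                    else a j)"

text \<open>Lists are read as the sequences \<open>k\<^sub>q, \<dots>, k\<^sub>1\<close>: the last entry acts first.\<close>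

primrec mutate_seq :: "(nat \<Rightarrow> nat \<Rightarrow> int) \<Rightarrow> nat list \<Rightarrow> nat \<Rightarrow> nat \<Rightarrow> int" where
  "mutate_seq B [] = B"
| "mutate_seq B (k # ks) = mutate k (mutate_seq B ks)"

primrec eta_seq :: "(nat \<Rightarrow> nat \<Rightarrow> int) \<Rightarrow> nat list \<Rightarrow> (nat \<Rightarrow> real) \<Rightarrow> nat \<Rightarrow> real" where
  "eta_seq B [] = id"
| "eta_seq B (k # ks) = eta (mutate_seq B ks) k \<circ> eta_seq B ks"

definition B_coherent ::
  "nat \<Rightarrow> (nat \<Rightarrow> nat \<Rightarrow> int) \<Rightarrow> 's set \<Rightarrow> ('s \<Rightarrow> real) \<Rightarrow> ('s \<Rightarrow> nat \<Rightarrow> real) \<Rightarrow> bool" where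
  "B_coherent n B S c v \<longleftrightarrow>
     (\<forall>ks. set ks \<subseteq> {1..n} \<longrightarrow> (\<forall>j\<in>{1..n}.
        (\<Sum>i\<in>S. c i * eta_seq B ks (v i) j) = 0 \<and>
        (\<Sum>i\<in>S. c i * min (eta_seq B ks (v i) j) 0) = 0))"

text \<open>
  In the first condition the formal expression ``\<open>a\<close> minus the combination'' is indexed by
  \<open>S\<close> together with one new index \<open>None\<close>, which carries the vector \<open>a\<close> with coefficient 1.
\<close>

definition R_basis ::
  "real set \<Rightarrow> nat \<Rightarrow> (nat \<Rightarrow> nat \<Rightarrow> int) \<Rightarrow> 'i set \<Rightarrow> ('i \<Rightarrow> nat \<Rightarrow> real) \<Rightarrow> bool" where
  "R_basis R n B I b \<longleftrightarrow>
     (\<forall>i\<in>I. \<forall>j\<in>{1..n}. b i j \<in> R) \<and>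
     (\<forall>a :: nat \<Rightarrow> real. (\<forall>j\<in>{1..n}. a j \<in> R) \<longrightarrow>
        (\<exists>S c. finite S \<and> S \<subseteq> I \<and> (\<forall>i\<in>S. c i \<in> R) \<and>
           B_coherent n B (insert None (Some ` S))
             (case_option 1 (\<lambda>i. - c i)) (case_option a b))) \<and>
     (\<forall>S c. finite S \<and> S \<subseteq> I \<and> (\<forall>i\<in>S. c i \<in> R) \<and> B_coherent n B S c b \<longrightarrow>
        (\<forall>i\<in>S. c i = 0))"

end

theory Submission
  imports Defs
begin

text \<open>
  A coefficient specialization is a choice of a continuous \<open>R\<close>-linear map \<open>\<theta>\<close> between the
  tropical semifields, and nothing more: \<open>\<theta>\<close> determines the images of all cluster variables, and
  every \<open>\<theta>\<close> compatible with the coefficients comes from a ring homomorphism.  The theorem follows by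
  translating such \<open>\<theta>\<close> into linear algebra of coefficient rows.

  The translation.  Mutation acts on a coefficient row as the mutation map, so the exponent of
  \<open>u\<^sub>i\<close> in the coefficient \<open>y\<^sub>j\<close> at \<open>t\<close> is the \<open>j\<close>-th entry of \<open>eta_seq B t (b i)\<close>
  (\<open>coeff_at_eq\<close>).  Since each factor \<open>R\<close> is discrete, a continuous linear map into one factor
  depends on finitely many exponents only (\<open>continuous_linear_component\<close>).  Hence \<open>\<theta>\<close> is a family
  of finite combinations, one for each row \<open>a\<close> of the target, and the conditions on \<open>y\<close> and \<open>y \<oplus> 1\<close>
  say precisely that \<open>a\<close> minus its combination is a coherent relation.  The tree only
  supplies reduced words, but mutation maps are involutions, so these account for all sequences
  (\<open>reduced_word\<close>).

  The extension of \<open>\<theta>\<close>.  The map \<open>\<theta>\<close> need not be injective, so it does not induce a map of the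
  ambient fields.  It does induce a homomorphism on polynomials in the initial cluster, which extends
  to the ring of those fractions whose denominator has nonzero image (\<open>extend_to_localization\<close>).
  This ring contains the inverse of each of its elements with nonzero image.  Going along the
  tree, each exchange relation divides by a cluster variable whose image is a cluster variable
  of the target; that image is nonzero, so all cluster variables lie in the ring and have the expected images
  (\<open>specialization_exists\<close>).  The fact that cluster variables are nonzero comes from
  the same localization argument, applied to the evaluation of all coefficients and all
  initial variables at 1: exchange relations are free of subtraction, so each cluster variable takes a
  positive rational value (\<open>cluster_var_nonzero\<close>).

  Conclusion.  If the rows are a basis, spanning gives a \<open>\<theta>\<close> for every target and
  independence makes it unique.  Conversely, a target with a single row \<open>a\<close> yields the
  expansion of \<open>a\<close>, and for the single row 0 every coherent relation among the \<open>b i\<close> gives a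
  specialization, which has to agree with that of the empty relation.
\<close>

section \<open>Ring homomorphisms on monoid rings\<close>

definition ring_map :: "('a::comm_ring_1 \<Rightarrow> 'b::comm_ring_1) \<Rightarrow> bool" where
  "ring_map f \<longleftrightarrow> f 1 = 1 \<and> (\<forall>a b. f (a + b) = f a + f b \<and> f (a * b) = f a * f b)"

lemma ring_mapD:
  assumes "ring_map f"
  shows "f 0 = 0" "f 1 = 1" "f (a + b) = f a + f b" "f (a * b) = f a * f b" "f (- a) = - f a"
    "f (a - b) = f a - f b"
proof -
  show *: "f 1 = 1" "f (a + b) = f a + f b" "f (a * b) = f a * f b" for a b
    using assms by (auto simp: ring_map_def)
  show z: "f 0 = 0" using *(2)[of 0 0] by simp
  have m: "f (- a) = - f a" for a using *(2)[of "-a" a] z by (simp add: eq_neg_iff_add_eq_0)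
  show "f (- a) = - f a" by (rule m)
  show "f (a - b) = f a - f b" using *(2)[of a "- b"] m[of b] by simp
qed

lemma ring_map_sum: "ring_map f \<Longrightarrow> f (\<Sum>i\<in>A. g i) = (\<Sum>i\<in>A. f (g i))"
  by (induction A rule: infinite_finite_induct) (auto simp: ring_mapD)

lemma ring_map_of_int: "ring_map f \<Longrightarrow> f (of_int m) = of_int m"
proof -
  assume f: "ring_map f"
  have "f (of_nat k) = of_nat k" for k by (induction k) (simp_all add: ring_mapD[OF f])
  then show ?thesis by (cases m) (simp_all add: ring_mapD[OF f] del: of_nat_Suc)
qed

definition monoid_ring_eval :: "('b::zero \<Rightarrow> 'f) \<Rightarrow> ('a \<Rightarrow> 'f) \<Rightarrow> ('a \<Rightarrow>\<^sub>0 'b) \<Rightarrow> 'f::comm_ring_1" where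
  "monoid_ring_eval c h f = (\<Sum>m\<in>Poly_Mapping.keys f. c (Poly_Mapping.lookup f m) * h m)"

lemma monoid_ring_eval_superset:
  assumes "c 0 = 0" "finite A" "Poly_Mapping.keys f \<subseteq> A"
  shows "monoid_ring_eval c h f = (\<Sum>m\<in>A. c (Poly_Mapping.lookup f m) * h m)"
  unfolding monoid_ring_eval_def
  by (rule sum.mono_neutral_left) (use assms in \<open>auto simp: in_keys_iff\<close>)

lemma monoid_ring_eval_single: "c 0 = 0 \<Longrightarrow> monoid_ring_eval c h (Poly_Mapping.single m a) = c a * h m"
  by (subst monoid_ring_eval_superset[of c "{m}"]) auto

text \<open>
  The universal property of the monoid ring.  It is used at two levels, as in the construction of the
  polynomial ring: for the exponent group over the rationals and for the monomials over the group ring.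
\<close>

lemma ring_map_monoid_ring_eval:
  fixes c :: "'b::comm_ring_1 \<Rightarrow> 'f::comm_ring_1" and h :: "'a::cancel_comm_monoid_add \<Rightarrow> 'f"
  assumes c: "ring_map c" and h: "h 0 = 1" "\<And>p q. h (p + q) = h p * h q"
  shows "ring_map (monoid_ring_eval c h)"
proof -
  note c0 = ring_mapD(1)[OF c]
  have one: "monoid_ring_eval c h 1 = 1"
    using monoid_ring_eval_single[of c h 0 1] c0 h ring_mapD(2)[OF c] by (simp add: single_one)
  have add: "monoid_ring_eval c h (f + g) = monoid_ring_eval c h f + monoid_ring_eval c h g" for f g
  proof -
    let ?A = "Poly_Mapping.keys f \<union> Poly_Mapping.keys g"
    have "monoid_ring_eval c h (f + g) = (\<Sum>m\<in>?A. c (Poly_Mapping.lookup (f + g) m) * h m)"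
      by (rule monoid_ring_eval_superset) (use c0 keys_add[of f g] in auto)
    also have "\<dots> = (\<Sum>m\<in>?A. c (Poly_Mapping.lookup f m) * h m) + (\<Sum>m\<in>?A. c (Poly_Mapping.lookup g m) * h m)"
      by (simp add: lookup_add ring_mapD[OF c] distrib_right sum.distrib)
    also have "\<dots> = monoid_ring_eval c h f + monoid_ring_eval c h g"
      using c0 by (simp add: monoid_ring_eval_superset[of c ?A])
    finally show ?thesis .
  qed
  have zero: "monoid_ring_eval c h 0 = 0" by (simp add: monoid_ring_eval_def)
  have sum: "monoid_ring_eval c h (\<Sum>i\<in>A. g i) = (\<Sum>i\<in>A. monoid_ring_eval c h (g i))" for A and g :: "'a \<Rightarrow> 'a \<Rightarrow>\<^sub>0 'b"
    by (induction A rule: infinite_finite_induct) (auto simp: zero add)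
  have mult: "monoid_ring_eval c h (f * g) = monoid_ring_eval c h f * monoid_ring_eval c h g" for f g
  proof -
    have "f * g = (\<Sum>m\<in>Poly_Mapping.keys f. Poly_Mapping.single m (Poly_Mapping.lookup f m)) *
       (\<Sum>m\<in>Poly_Mapping.keys g. Poly_Mapping.single m (Poly_Mapping.lookup g m))"
      by (simp add: sum_monos)
    also have "\<dots> = (\<Sum>m\<in>Poly_Mapping.keys f. \<Sum>k\<in>Poly_Mapping.keys g.
        Poly_Mapping.single (m + k) (Poly_Mapping.lookup f m * Poly_Mapping.lookup g k))"
      by (simp add: sum_product mult_single)
    finally have "monoid_ring_eval c h (f * g) = (\<Sum>m\<in>Poly_Mapping.keys f. \<Sum>k\<in>Poly_Mapping.keys g.
        c (Poly_Mapping.lookup f m * Poly_Mapping.lookup g k) * h (m + k))"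
      by (simp add: sum monoid_ring_eval_single c0)
    also have "\<dots> = monoid_ring_eval c h f * monoid_ring_eval c h g"
      unfolding monoid_ring_eval_def sum_product
      by (intro sum.cong refl) (simp add: h ring_mapD[OF c] mult_ac)
    finally show ?thesis .
  qed
  show ?thesis using one add mult by (simp add: ring_map_def)
qed

definition monomial_value :: "(nat \<Rightarrow> 'f) \<Rightarrow> (nat \<Rightarrow>\<^sub>0 nat) \<Rightarrow> 'f::comm_ring_1" where
  "monomial_value v m = (\<Prod>j\<in>Poly_Mapping.keys m. v j ^ Poly_Mapping.lookup m j)"

lemma monomial_value_superset:
  assumes "finite A" "Poly_Mapping.keys m \<subseteq> A"
  shows "monomial_value v m = (\<Prod>j\<in>A. v j ^ Poly_Mapping.lookup m j)"
  unfolding monomial_value_def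
  by (rule prod.mono_neutral_left) (use assms in \<open>auto simp: in_keys_iff\<close>)

lemma monomial_value_0: "monomial_value v 0 = 1"
  by (simp add: monomial_value_def)

lemma monomial_value_add: "monomial_value v (m + k) = monomial_value v m * monomial_value v k"
proof -
  let ?A = "Poly_Mapping.keys m \<union> Poly_Mapping.keys k"
  have "monomial_value v (m + k) = (\<Prod>j\<in>?A. v j ^ Poly_Mapping.lookup (m + k) j)"
    by (rule monomial_value_superset) (use keys_add[of m k] in auto)
  then show ?thesis
    by (simp add: monomial_value_superset[of ?A] lookup_add power_add prod.distrib)
qed

lemma monomial_value_single: "monomial_value v (Poly_Mapping.single j 1) = v j"
  by (subst monomial_value_superset[of "{j}"]) auto

lemma ring_map_const: "ring_map (const :: ('i trop \<Rightarrow>\<^sub>0 rat) \<Rightarrow> 'i ratfun)"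
  by (auto simp: ring_map_def const_def single_add mult_single single_one One_fract_def)

lemma trop_emb_0: "trop_emb 0 = 1"
  using ring_mapD(2)[OF ring_map_const] by (simp add: trop_emb_def single_one)

lemma trop_emb_add: "trop_emb (p + q) = trop_emb p * trop_emb q"
  using ring_mapD(4)[OF ring_map_const, of "Poly_Mapping.single p 1" "Poly_Mapping.single q 1"]
  by (simp add: trop_emb_def mult_single)

lemma trop_emb_eq_iff: "trop_emb p = trop_emb q \<longleftrightarrow> p = q"
  by (auto simp: trop_emb_def const_def eq_fract dest!: Poly_Mapping.poly_mapping_eqI)
    (metis lookup_single_eq lookup_single_not_eq one_neq_zero)

lemma trop_emb_nonzero: "trop_emb p \<noteq> 0"
proof
  assume "trop_emb p = 0"
  then have "trop_emb (p + (- p)) = 0" by (simp only: trop_emb_add) simp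
  then show False by (simp add: trop_emb_0)
qed

lemma poly_eval_eq: "poly_eval x = monoid_ring_eval const (monomial_value x)"
  by (auto simp: poly_eval_def monoid_ring_eval_def monomial_value_def)

section \<open>Extending a homomorphism to a localization\<close>

text \<open>
  Equivalently, \<open>L\<close> is a local subring of the field, with the kernel of \<open>\<Psi>\<close> as its maximal ideal: a
  homomorphism to a field that is defined as far as division is possible in the target.
\<close>

definition local_hom :: "'k::field set \<Rightarrow> ('k \<Rightarrow> 'f::field) \<Rightarrow> bool" where
  "local_hom L \<Psi> \<longleftrightarrow> is_subring L \<and> ring_hom_on L UNIV \<Psi> \<and> (\<forall>a\<in>L. \<Psi> a \<noteq> 0 \<longrightarrow> inverse a \<in> L)"

lemma is_subringD:
  assumes "is_subring A"
  shows "1 \<in> A" "0 \<in> A" "\<And>a b. a \<in> A \<Longrightarrow> b \<in> A \<Longrightarrow> a - b \<in> A"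
    "\<And>a b. a \<in> A \<Longrightarrow> b \<in> A \<Longrightarrow> a * b \<in> A" "\<And>a. a \<in> A \<Longrightarrow> - a \<in> A"
    "\<And>a b. a \<in> A \<Longrightarrow> b \<in> A \<Longrightarrow> a + b \<in> A"
proof -
  show *: "1 \<in> A" "\<And>a b. a \<in> A \<Longrightarrow> b \<in> A \<Longrightarrow> a - b \<in> A" "\<And>a b. a \<in> A \<Longrightarrow> b \<in> A \<Longrightarrow> a * b \<in> A"
    using assms by (auto simp: is_subring_def)
  show z: "0 \<in> A" using *(2)[OF *(1) *(1)] by simp
  show m: "- a \<in> A" if "a \<in> A" for a using *(2)[OF z that] by simp
  show "a + b \<in> A" if "a \<in> A" "b \<in> A" for a b using *(2)[OF that(1) m[OF that(2)]] by simp
qed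

lemma is_subring_sum: "is_subring A \<Longrightarrow> (\<And>i. i \<in> X \<Longrightarrow> f i \<in> A) \<Longrightarrow> (\<Sum>i\<in>X. f i) \<in> A"
  by (induction X rule: infinite_finite_induct) (auto simp: is_subringD)

lemma is_subring_prod: "is_subring A \<Longrightarrow> (\<And>i. i \<in> X \<Longrightarrow> f i \<in> A) \<Longrightarrow> (\<Prod>i\<in>X. f i) \<in> A"
  for f :: "'b \<Rightarrow> 'a::comm_ring_1"
  by (induction X rule: infinite_finite_induct) (auto simp: is_subringD)

lemma is_subring_power: "is_subring A \<Longrightarrow> a \<in> A \<Longrightarrow> a ^ k \<in> A"
  by (induction k) (auto simp: is_subringD)

lemma is_subring_hull: "is_subring (is_subring hull S)"
  by (rule hull_in) (auto simp: is_subring_def)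

lemma ring_hom_onD:
  assumes "ring_hom_on A A' \<phi>" "is_subring A"
  shows "\<phi> 0 = 0" "\<phi> 1 = 1" "\<And>a b. a \<in> A \<Longrightarrow> b \<in> A \<Longrightarrow> \<phi> (a + b) = \<phi> a + \<phi> b"
    "\<And>a b. a \<in> A \<Longrightarrow> b \<in> A \<Longrightarrow> \<phi> (a * b) = \<phi> a * \<phi> b"
    "\<And>a b. a \<in> A \<Longrightarrow> b \<in> A \<Longrightarrow> \<phi> (a - b) = \<phi> a - \<phi> b"
    "\<And>a. a \<in> A \<Longrightarrow> \<phi> a \<in> A'"
proof -
  note s = is_subringD[OF assms(2)]
  show *: "\<phi> 1 = 1" "\<And>a b. a \<in> A \<Longrightarrow> b \<in> A \<Longrightarrow> \<phi> (a + b) = \<phi> a + \<phi> b"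
    "\<And>a b. a \<in> A \<Longrightarrow> b \<in> A \<Longrightarrow> \<phi> (a * b) = \<phi> a * \<phi> b" "\<And>a. a \<in> A \<Longrightarrow> \<phi> a \<in> A'"
    using assms(1) by (auto simp: ring_hom_on_def)
  show "\<phi> 0 = 0" using *(2)[OF s(2) s(2)] by simp
  show "\<phi> (a - b) = \<phi> a - \<phi> b" if "a \<in> A" "b \<in> A" for a b
    using *(2)[OF s(3)[OF that] that(2)] by simp
qed

lemma ring_hom_on_prod:
  fixes f :: "'b \<Rightarrow> 'a::comm_ring_1" and \<phi> :: "'a \<Rightarrow> 'c::comm_ring_1"
  assumes "ring_hom_on A A' \<phi>" "is_subring A" "\<And>i. i \<in> X \<Longrightarrow> f i \<in> A"
  shows "\<phi> (\<Prod>i\<in>X. f i) = (\<Prod>i\<in>X. \<phi> (f i))"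
  using assms(3)
  by (induction X rule: infinite_finite_induct)
    (auto simp: ring_hom_onD[OF assms(1,2)] is_subring_prod[OF assms(2)])

lemma ring_hom_on_power:
  fixes \<phi> :: "'a::ring_1 \<Rightarrow> 'c::ring_1"
  assumes "ring_hom_on A A' \<phi>" "is_subring A" "a \<in> A"
  shows "\<phi> (a ^ k) = \<phi> a ^ k"
  by (induction k) (auto simp: ring_hom_onD[OF assms(1,2)] assms(3) is_subring_power[OF assms(2,3)])

text \<open>
  Fractions \<open>e f / e g\<close> with \<open>\<psi> g \<noteq> 0\<close> can be sent to \<open>\<psi> f / \<psi> g\<close>; two representations of the same
  fraction differ by an element of the kernel of \<open>e\<close>, which \<open>\<psi>\<close> kills too.  Such a fraction
  with nonzero image has \<open>\<psi> f \<noteq> 0\<close>, so its inverse is again of this form.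
\<close>

lemma extend_to_localization:
  fixes e :: "'r::comm_ring_1 \<Rightarrow> 'k::field" and \<psi> :: "'r \<Rightarrow> 'f::field"
  assumes e: "ring_map e" and \<psi>: "ring_map \<psi>" and P: "is_subring P"
    and ker: "\<And>g. g \<in> P \<Longrightarrow> e g = 0 \<Longrightarrow> \<psi> g = 0"
  obtains L \<Psi> where "local_hom L \<Psi>" "\<And>g. g \<in> P \<Longrightarrow> e g \<in> L" "\<And>g. g \<in> P \<Longrightarrow> \<Psi> (e g) = \<psi> g"
proof -
  define frac where "frac z f g \<longleftrightarrow> f \<in> P \<and> g \<in> P \<and> \<psi> g \<noteq> 0 \<and> z = e f / e g" for z f g
  define L where "L = {z. \<exists>f g. frac z f g}"
  define \<Psi> where "\<Psi> z = (SOME w. \<exists>f g. frac z f g \<and> w = \<psi> f / \<psi> g)" for z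
  note P' = is_subringD[OF P] and e' = ring_mapD[OF e] and \<psi>' = ring_mapD[OF \<psi>]
  have eq: "\<psi> f / \<psi> g = \<psi> f' / \<psi> g'" if "frac z f g" "frac z f' g'" for z f g f' g'
  proof -
    have "e g \<noteq> 0" "e g' \<noteq> 0" using that ker by (auto simp: frac_def)
    then have "e (f * g' - f' * g) = 0"
      using that by (auto simp: frac_def e' frac_eq_eq)
    then have "\<psi> (f * g' - f' * g) = 0"
      using that ker P' by (auto simp: frac_def)
    then show ?thesis using that by (auto simp: frac_def \<psi>' field_simps)
  qed
  have \<Psi>: "\<Psi> z = \<psi> f / \<psi> g" if "frac z f g" for z f g
  proof -
    have "\<exists>w f g. frac z f g \<and> w = \<psi> f / \<psi> g" using that by blast
    then have "\<exists>f g. frac z f g \<and> \<Psi> z = \<psi> f / \<psi> g"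
      unfolding \<Psi>_def by (rule someI_ex)
    then show ?thesis using eq that by metis
  qed
  have F: "e g \<noteq> 0" if "frac z f g" for z f g using that ker by (auto simp: frac_def)
  have in_P: "frac (e g) g 1" if "g \<in> P" for g using that P' by (auto simp: frac_def e' \<psi>')
  have diff: "frac (a - b) (f * g' - f' * g) (g * g')"
    and mult: "frac (a * b) (f * f') (g * g')"
    and add: "frac (a + b) (f * g' + f' * g) (g * g')"
    if "frac a f g" "frac b f' g'" for a b f g f' g'
    using that F[OF that(1)] F[OF that(2)]
    by (auto simp: frac_def e' \<psi>' P' add_frac_eq diff_frac_eq)
  have "is_subring L"
    unfolding is_subring_def
  proof (intro conjI ballI)
    show "1 \<in> L" using in_P[of 1] P' by (auto simp: L_def e')
  next
    fix a b assume "a \<in> L" "b \<in> L"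
    then obtain f g f' g' where ab: "frac a f g" "frac b f' g'" by (auto simp: L_def)
    show "a - b \<in> L" "a * b \<in> L" using diff[OF ab] mult[OF ab] unfolding L_def by blast+
  qed
  moreover have "ring_hom_on L UNIV \<Psi>"
    unfolding ring_hom_on_def
  proof (intro conjI ballI)
    show "\<Psi> 1 = 1" using \<Psi>[OF in_P[of 1]] P' by (simp add: e' \<psi>')
  next
    fix a b assume "a \<in> L" "b \<in> L"
    then obtain f g f' g' where ab: "frac a f g" "frac b f' g'" by (auto simp: L_def)
    have nz: "\<psi> g \<noteq> 0" "\<psi> g' \<noteq> 0" using ab by (auto simp: frac_def)
    show "\<Psi> (a + b) = \<Psi> a + \<Psi> b" "\<Psi> (a * b) = \<Psi> a * \<Psi> b"
      unfolding \<Psi>[OF add[OF ab]] \<Psi>[OF mult[OF ab]] \<Psi>[OF ab(1)] \<Psi>[OF ab(2)]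
      using nz by (simp_all add: \<psi>' add_frac_eq)
  qed auto
  moreover have "inverse a \<in> L" if a: "a \<in> L" "\<Psi> a \<noteq> 0" for a
  proof -
    obtain f g where fg: "frac a f g" using a(1) by (auto simp: L_def)
    then have "frac (inverse a) g f" using \<Psi>[OF fg] a(2) by (auto simp: frac_def)
    then show ?thesis by (auto simp: L_def)
  qed
  ultimately have "local_hom L \<Psi>" by (auto simp: local_hom_def)
  then show ?thesis
  proof
    fix g assume "g \<in> P"
    note * = in_P[OF this]
    show "e g \<in> L" using * by (auto simp: L_def)
    show "\<Psi> (e g) = \<psi> g" using \<Psi>[OF *] by (simp add: \<psi>')
  qed
qed

section \<open>Mutation of rows and mutation maps\<close>

lemma mutate_seed_snd: "snd (mutate_seed n I k \<Sigma>) = mutate_ext k (snd \<Sigma>)"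
  by (simp add: mutate_seed_def case_prod_unfold)

text \<open>
  The sign cases of the mutation map are those in which \<open>a\<^sub>k b\<^sub>k\<^sub>j\<close> is nonnegative; there it
  contributes with the sign of \<open>b\<^sub>k\<^sub>j\<close>, just as in the mutation of a coefficient row.
\<close>

lemma mutate_ext_eta:
  "mutate_ext k (B, C) = (mutate k B, \<lambda>i. eta B k (C i))"
proof -
  have "C i j + of_int (sgn (B k j)) * max (C i k * of_int (B k j)) 0 = eta B k (C i) j"
    if "j \<noteq> k" for i j
  proof -
    consider "B k j = 0" | "B k j > 0" | "B k j < 0" by linarith
    then show ?thesis
      using that by cases (auto simp: eta_def max_def mult_le_0_iff zero_le_mult_iff not_le)
  qed
  then show ?thesis by (auto simp: mutate_ext_def eta_def fun_eq_iff)
qed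

lemma snd_seed_at:
  "snd (seed_at n I (x, (B, b)) t) = (mutate_seq B t, \<lambda>i. eta_seq B t (b i))"
  by (induction t) (auto simp: mutate_seed_snd mutate_ext_eta)

lemma coeff_at_eq:
  "coeff_at n I (x, (B, b)) t j = Trop (\<lambda>i. if i \<in> I then eta_seq B t (b i) j else 0)"
  by (simp add: coeff_at_def coeff_def snd_seed_at cong: if_cong)

lemma mutate_mutate: "mutate k (mutate k B) = B"
  by (auto simp: mutate_def fun_eq_iff)

lemma eta_eta: "eta (mutate k B) k (eta B k a) = a"
  by (auto simp: eta_def mutate_def fun_eq_iff)

text \<open>
  Two equal adjacent letters cancel because mutation and mutation maps are involutive.  So conditions at the
  vertices of the tree, whose words are reduced, amount to conditions for all sequences.
\<close>

lemma reduced_word: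
  "\<exists>t. distinct_adj t \<and> set t \<subseteq> set ks \<and> mutate_seq B t = mutate_seq B ks \<and> eta_seq B t = eta_seq B ks"
proof (induction ks)
  case Nil
  show ?case by (intro exI[of _ "[]"]) auto
next
  case (Cons k ks)
  then obtain t where t: "distinct_adj t" "set t \<subseteq> set ks" "mutate_seq B t = mutate_seq B ks"
    "eta_seq B t = eta_seq B ks" by blast
  show ?case
  proof (cases "\<exists>t'. t = k # t'")
    case True
    then obtain t' where t': "t = k # t'" by blast
    have "mutate_seq B (k # ks) = mutate_seq B t'" "eta_seq B (k # ks) = eta_seq B t'"
      using t(3,4) t' by (auto simp: mutate_mutate eta_eta fun_eq_iff simp flip: t(3,4))
    then show ?thesis using t t' by (intro exI[of _ t']) (auto dest: distinct_adj_ConsD)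
  next
    case False
    then have "distinct_adj (k # t)" using t(1) by (cases t) auto
    then show ?thesis using t by (intro exI[of _ "k # t"]) auto
  qed
qed

text \<open>
  Matrices with the same exchange matrix may still differ at junk indices outside \<open>[n]\<close>; this and the next lemma
  say that mutation never lets the difference reach the indices in \<open>[n]\<close>.
\<close>

lemma mutate_seq_cong:
  assumes "\<And>i j. i \<in> {1..n} \<Longrightarrow> j \<in> {1..n} \<Longrightarrow> B i j = B' i j" "set ks \<subseteq> {1..n}"
    "i \<in> {1..n}" "j \<in> {1..n}"
  shows "mutate_seq B ks i j = mutate_seq B' ks i j"
  using assms(2-) by (induction ks arbitrary: i j) (auto simp: assms(1) mutate_def)

lemma eta_seq_cong:
  assumes "\<And>i j. i \<in> {1..n} \<Longrightarrow> j \<in> {1..n} \<Longrightarrow> B i j = B' i j" "set ks \<subseteq> {1..n}" "j \<in> {1..n}"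
  shows "eta_seq B ks a j = eta_seq B' ks a j"
  using assms(2-)
proof (induction ks arbitrary: j)
  case (Cons k ks)
  have "mutate_seq B ks k j = mutate_seq B' ks k j"
    by (rule mutate_seq_cong[OF assms(1)]) (use Cons.prems in auto)
  then show ?case using Cons by (auto simp: eta_def)
qed auto

lemma underlying_ringD:
  assumes "underlying_ring R"
  shows "is_subring R" "of_int k \<in> R"
proof -
  show s: "is_subring R"
    using assms by (auto simp: underlying_ring_def is_subfield_def is_subring_def)
  show "of_int k \<in> R"
    using assms by (auto simp: underlying_ring_def)
qed

lemma eta_seq_in:
  assumes "underlying_ring R" "\<And>j. j \<in> {1..n} \<Longrightarrow> a j \<in> R" "set ks \<subseteq> {1..n}" "j \<in> {1..n}"
  shows "eta_seq B ks a j \<in> R"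
  using assms(3-)
proof (induction ks arbitrary: j)
  case (Cons k ks)
  note s = is_subringD[OF underlying_ringD(1)[OF assms(1)]] underlying_ringD(2)[OF assms(1)]
  show ?case using Cons by (auto simp: eta_def s)
qed (use assms(2) in auto)

lemma coeff_at_in:
  assumes "underlying_ring R" "extended_exchange_matrix R n I (B, b)" "set t \<subseteq> {1..n}" "j \<in> {1..n}"
  shows "coeff_at n I (x, (B, b)) t j \<in> trop_group R I"
    "trop_oplus (coeff_at n I (x, (B, b)) t j) 0 \<in> trop_group R I"
proof -
  have "eta_seq B t (b i) j \<in> R" if "i \<in> I" for i
    by (rule eta_seq_in) (use assms that in \<open>auto simp: extended_exchange_matrix_def\<close>)
  moreover have "0 \<in> R" by (rule is_subringD(2)[OF underlying_ringD(1)[OF assms(1)]])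
  ultimately show "coeff_at n I (x, (B, b)) t j \<in> trop_group R I"
    "trop_oplus (coeff_at n I (x, (B, b)) t j) 0 \<in> trop_group R I"
    by (auto simp: coeff_at_eq trop_group_def trop_oplus_def zero_trop_def min_def)
qed

section \<open>Cluster variables under partial homomorphisms\<close>

text \<open>
  The right-hand side of the exchange relation, over any field.  Abstracting from the semifield
  allows one to apply a homomorphism to it; \<open>y\<close> is the coefficient and \<open>z\<close> stands for \<open>y \<oplus> 1\<close>.
\<close>

definition exchange :: "nat \<Rightarrow> (nat \<Rightarrow> nat \<Rightarrow> int) \<Rightarrow> nat \<Rightarrow> (nat \<Rightarrow> 'f) \<Rightarrow> 'f \<Rightarrow> 'f \<Rightarrow> 'f::field" where
  "exchange n B k x y z =
     (y * (\<Prod>i\<in>{1..n}. x i ^ nat (max (B i k) 0)) + (\<Prod>i\<in>{1..n}. x i ^ nat (max (- B i k) 0))) / (x k * z)"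

lemma exchange_cong:
  assumes "\<And>i. i \<in> {1..n} \<Longrightarrow> B i k = B' i k" "\<And>i. i \<in> {1..n} \<Longrightarrow> x i = x' i" "k \<in> {1..n}"
  shows "exchange n B k x y z = exchange n B' k x' y z"
  unfolding exchange_def using assms by (auto intro!: arg_cong2[where f = "(/)"] arg_cong2[where f = "(+)"] prod.cong)

lemma cluster_var_Nil: "cluster_var n I \<Sigma> [] j = fst \<Sigma> j"
  by (simp add: cluster_var_def)

lemma cluster_var_Cons:
  "cluster_var n I (x, (B, b)) (k # t) j =
    (if j = k then exchange n (mutate_seq B t) k (cluster_var n I (x, (B, b)) t)
        (trop_emb (coeff_at n I (x, (B, b)) t k)) (trop_emb (trop_oplus (coeff_at n I (x, (B, b)) t k) 0))
     else cluster_var n I (x, (B, b)) t j)"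
  using snd_seed_at[of n I x B b t]
  by (simp add: cluster_var_def[abs_def] mutate_seed_def case_prod_unfold exchange_def coeff_at_def)

text \<open>
  The denominator is cleared first, since \<open>1 / x k\<close> and \<open>1 / z\<close> may lie outside \<open>A\<close>, as happens when
  \<open>A\<close> is a cluster algebra.
\<close>

lemma ring_hom_on_exchange:
  fixes \<phi> :: "'a::field \<Rightarrow> 'b::field"
  assumes h: "ring_hom_on A A' \<phi>" and s: "is_subring A" and A: "exchange n B k x y z \<in> A"
    and x: "\<And>i. i \<in> {1..n} \<Longrightarrow> x i \<in> A" and k: "k \<in> {1..n}" and yz: "y \<in> A" "z \<in> A"
    and nz: "\<phi> (x k) \<noteq> 0" "\<phi> z \<noteq> 0"
  shows "\<phi> (exchange n B k x y z) = exchange n B k (\<lambda>i. \<phi> (x i)) (\<phi> y) (\<phi> z)"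
proof -
  note s' = is_subringD[OF s] and h' = ring_hom_onD[OF h s]
  define M where "M f = (\<Prod>i\<in>{1..n}. x i ^ f i)" for f :: "nat \<Rightarrow> nat"
  have M: "M f \<in> A" "\<phi> (M f) = (\<Prod>i\<in>{1..n}. \<phi> (x i) ^ f i)" for f
  proof -
    have *: "x i ^ f i \<in> A" if "i \<in> {1..n}" for i using x[OF that] by (rule is_subring_power[OF s])
    then show "M f \<in> A" unfolding M_def by (rule is_subring_prod[OF s])
    have "\<phi> (M f) = (\<Prod>i\<in>{1..n}. \<phi> (x i ^ f i))"
      unfolding M_def by (rule ring_hom_on_prod[OF h s *])
    also have "\<dots> = (\<Prod>i\<in>{1..n}. \<phi> (x i) ^ f i)"
      by (intro prod.cong refl ring_hom_on_power[OF h s] x)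
    finally show "\<phi> (M f) = (\<Prod>i\<in>{1..n}. \<phi> (x i) ^ f i)" .
  qed
  have "x k \<noteq> 0" "z \<noteq> 0" using nz h'(1) by auto
  then have "exchange n B k x y z * (x k * z) = y * M (\<lambda>i. nat (max (B i k) 0)) + M (\<lambda>i. nat (max (- B i k) 0))"
    by (simp add: exchange_def M_def)
  then have "\<phi> (exchange n B k x y z * (x k * z)) = \<phi> (y * M (\<lambda>i. nat (max (B i k) 0)) + M (\<lambda>i. nat (max (- B i k) 0)))"
    by simp
  then have "\<phi> (exchange n B k x y z) * (\<phi> (x k) * \<phi> z) = \<phi> y * \<phi> (M (\<lambda>i. nat (max (B i k) 0))) + \<phi> (M (\<lambda>i. nat (max (- B i k) 0)))"
    using A x[OF k] yz M(1) by (simp add: h' s')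
  then show ?thesis
    using nz unfolding M exchange_def by (simp add: eq_divide_eq)
qed

lemma local_hom_exchange:
  assumes "local_hom L \<Psi>" "\<And>i. i \<in> {1..n} \<Longrightarrow> x i \<in> L" "k \<in> {1..n}" "y \<in> L" "z \<in> L"
    "\<Psi> (x k) \<noteq> 0" "\<Psi> z \<noteq> 0"
  shows "exchange n B k x y z \<in> L"
    "\<Psi> (exchange n B k x y z) = exchange n B k (\<lambda>i. \<Psi> (x i)) (\<Psi> y) (\<Psi> z)"
proof -
  have s: "is_subring L" and h: "ring_hom_on L UNIV \<Psi>" using assms(1) by (auto simp: local_hom_def)
  note s' = is_subringD[OF s] and h' = ring_hom_onD[OF h s]
  have "x k * z \<in> L" "\<Psi> (x k * z) \<noteq> 0" using assms(2)[OF assms(3)] assms(5-7) by (auto simp: s' h')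
  then have inv: "inverse (x k * z) \<in> L" using assms(1) by (auto simp: local_hom_def)
  show L: "exchange n B k x y z \<in> L"
    unfolding exchange_def divide_inverse
    by (intro s' inv assms is_subring_prod[OF s] is_subring_power[OF s])
  show "\<Psi> (exchange n B k x y z) = exchange n B k (\<lambda>i. \<Psi> (x i)) (\<Psi> y) (\<Psi> z)"
    by (rule ring_hom_on_exchange[OF h s L assms(2-7)])
qed

text \<open>
  By algebraic independence of the cluster, values \<open>h\<close> of the formal products and \<open>v\<close> of the cluster variables can be
  prescribed at will in another field, at the price of restricting to a local ring.
\<close>

lemma seed_evaluation:
  fixes c :: "rat \<Rightarrow> 'f::field" and h :: "'i trop \<Rightarrow> 'f" and v :: "nat \<Rightarrow> 'f"
  assumes R: "underlying_ring R" and seed: "is_seed R n I (x, Bt)"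
    and c: "ring_map c" and h: "h 0 = 1" "\<And>p q. h (p + q) = h p * h q"
  obtains L \<Psi> where "local_hom L \<Psi>"
    "\<And>a. a \<in> group_ring_Q R I \<Longrightarrow> const a \<in> L"
    "\<And>a. a \<in> group_ring_Q R I \<Longrightarrow> \<Psi> (const a) = monoid_ring_eval c h a"
    "\<And>j. j \<in> {1..n} \<Longrightarrow> x j \<in> L" "\<And>j. j \<in> {1..n} \<Longrightarrow> \<Psi> (x j) = v j"
proof -
  have e: "ring_map (poly_eval x)"
    unfolding poly_eval_eq
    by (intro ring_map_monoid_ring_eval ring_map_const monomial_value_0 monomial_value_add)
  have c': "ring_map (monoid_ring_eval c h)" by (intro ring_map_monoid_ring_eval c h)
  define \<psi> where "\<psi> = monoid_ring_eval (monoid_ring_eval c h) (monomial_value v)"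
  have \<psi>: "ring_map \<psi>"
    unfolding \<psi>_def by (intro ring_map_monoid_ring_eval c' monomial_value_0 monomial_value_add)
  have P: "is_subring (polys R I n)"
    unfolding is_subring_def
    using pol_1[OF R] pol_mult[OF R] pol_add[OF R] pol_uminus[OF R] by (metis add_uminus_conv_diff)
  have ker: "\<psi> g = 0" if "g \<in> polys R I n" "poly_eval x g = 0" for g
    using seed that ring_mapD(1)[OF \<psi>] by (auto simp: is_seed_def)
  obtain L \<Psi> where L: "local_hom L \<Psi>" "\<And>g. g \<in> polys R I n \<Longrightarrow> poly_eval x g \<in> L"
    "\<And>g. g \<in> polys R I n \<Longrightarrow> \<Psi> (poly_eval x g) = \<psi> g"
    using extend_to_localization[OF e \<psi> P ker] by metis
  show ?thesis
  proof (rule that[OF L(1)])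
    fix a assume a: "a \<in> group_ring_Q R I"
    have *: "Poly_Mapping.single 0 a \<in> polys R I n" using a by (intro pol_single[OF R]) auto
    have eq: "poly_eval x (Poly_Mapping.single 0 a) = const a"
      by (simp add: poly_eval_eq monoid_ring_eval_single ring_mapD[OF ring_map_const] monomial_value_0)
    show "const a \<in> L" using L(2)[OF *] eq by simp
    show "\<Psi> (const a) = monoid_ring_eval c h a"
      using L(3)[OF *] eq by (simp add: \<psi>_def monoid_ring_eval_single ring_mapD[OF c'] monomial_value_0)
  next
    fix j assume j: "j \<in> {1..n}"
    let ?f = "Poly_Mapping.single (Poly_Mapping.single j 1) 1 :: 'i poly_ring"
    have *: "?f \<in> polys R I n" using j by (intro pol_single[OF R] gr_1[OF R]) auto
    have eq: "poly_eval x ?f = x j"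
      by (simp add: poly_eval_eq monoid_ring_eval_single ring_mapD[OF ring_map_const] monomial_value_single del: One_nat_def)
    show "x j \<in> L" using L(2)[OF *] eq by simp
    show "\<Psi> (x j) = v j"
      using L(3)[OF *] eq by (simp add: \<psi>_def monoid_ring_eval_single ring_mapD[OF c'] monomial_value_single del: One_nat_def)
  qed
qed

lemma trop_emb_in_group_ring: "p \<in> trop_group R I \<Longrightarrow> Poly_Mapping.single p 1 \<in> group_ring_Z R I"
  by (auto simp: group_ring_Z_def group_ring_Q_def lookup_single when_def)

text \<open>
  Set all formal products and all initial cluster variables equal to 1.  The exchange relation
  involves no subtraction, so by induction every cluster variable can be evaluated and has a
  positive value.
\<close>

lemma cluster_var_nonzero:
  assumes R: "underlying_ring R" and seed: "is_seed R n I (x, (B, b))"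
    and t: "set t \<subseteq> {1..n}" and j: "j \<in> {1..n}"
  shows "cluster_var n I (x, (B, b)) t j \<noteq> 0"
proof -
  have ext: "extended_exchange_matrix R n I (B, b)" using seed by (simp add: is_seed_def)
  have c: "ring_map (\<lambda>r::rat. r)" by (simp add: ring_map_def)
  obtain L and \<Psi> :: "'a ratfun \<Rightarrow> rat" where L: "local_hom L \<Psi>"
    "\<And>a. a \<in> group_ring_Q R I \<Longrightarrow> const a \<in> L"
    "\<And>a. a \<in> group_ring_Q R I \<Longrightarrow> \<Psi> (const a) = monoid_ring_eval (\<lambda>r. r) (\<lambda>_. 1) a"
    "\<And>j. j \<in> {1..n} \<Longrightarrow> x j \<in> L" "\<And>j. j \<in> {1..n} \<Longrightarrow> \<Psi> (x j) = 1"
    by (rule seed_evaluation[OF R seed c, of "\<lambda>_. 1" "\<lambda>_. 1"]) auto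
  have emb: "trop_emb p \<in> L \<and> \<Psi> (trop_emb p) = 1" if "p \<in> trop_group R I" for p
    using trop_emb_in_group_ring[OF that] L(2,3)[of "Poly_Mapping.single p 1"]
    by (simp add: trop_emb_def group_ring_Z_def monoid_ring_eval_single)
  have "cluster_var n I (x, (B, b)) t j \<in> L \<and> \<Psi> (cluster_var n I (x, (B, b)) t j) > 0"
    using t j
  proof (induction t arbitrary: j)
    case Nil
    then show ?case using L by (simp add: cluster_var_Nil)
  next
    case (Cons k t)
    show ?case
    proof (cases "j = k")
      case True
      have k: "k \<in> {1..n}" and t: "set t \<subseteq> {1..n}" using Cons.prems by auto
      let ?x = "cluster_var n I (x, (B, b)) t"
      note IH = Cons.IH[OF t]
      note y = emb[OF coeff_at_in(1)[OF R ext t k]] emb[OF coeff_at_in(2)[OF R ext t k]]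
      have "exchange n (mutate_seq B t) k (\<lambda>i. \<Psi> (?x i)) 1 1 > 0"
        unfolding exchange_def using IH k by (auto intro!: divide_pos_pos add_pos_pos prod_pos)
      moreover have "\<Psi> (?x k) \<noteq> 0" using IH[OF k] by simp
      ultimately show ?thesis
        unfolding cluster_var_Cons using True y
          local_hom_exchange[OF L(1) conjunct1[OF IH] k conjunct1[OF y(1)] conjunct1[OF y(2)]]
        by simp
    next
      case False
      then show ?thesis using Cons by (simp add: cluster_var_Cons)
    qed
  qed
  then have "\<Psi> (cluster_var n I (x, (B, b)) t j) \<noteq> \<Psi> 0"
    using ring_hom_onD(1)[of L UNIV \<Psi>] L(1) by (auto simp: local_hom_def)
  then show ?thesis by metis
qed

section \<open>Continuous linear maps of tropical semifields\<close>

text \<open>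
  Exponents of \<open>lin_map J S c p\<close> outside \<open>J\<close> are set to 0, as \<open>trop_group\<close> demands.  The formula is additive
  on all of \<open>'i trop\<close>, not only on \<open>trop_group R I\<close>, so that it extends to the whole group ring.
\<close>

definition lin_map :: "'j set \<Rightarrow> ('j \<Rightarrow> 'i set) \<Rightarrow> ('j \<Rightarrow> 'i \<Rightarrow> real) \<Rightarrow> 'i trop \<Rightarrow> 'j trop" where
  "lin_map J S c p = Trop (\<lambda>j. if j \<in> J then \<Sum>i\<in>S j. c j i * expo p i else 0)"

lemma expo_simps: "expo 0 i = 0" "expo (p + q) i = expo p i + expo q i" "expo (p - q) i = expo p i - expo q i"
  "expo (trop_scale r p) i = r * expo p i" "expo (trop_oplus p q) i = min (expo p i) (expo q i)"
  by (simp_all add: zero_trop_def plus_trop_def minus_trop_def trop_scale_def trop_oplus_def)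

lemma expo_sum: "expo (\<Sum>x\<in>A. f x) i = (\<Sum>x\<in>A. expo (f x) i)"
  by (induction A rule: infinite_finite_induct) (auto simp: expo_simps)

lemma lin_map_0: "lin_map J S c 0 = 0"
  by (auto simp: lin_map_def zero_trop_def fun_eq_iff)

lemma lin_map_add: "lin_map J S c (p + q) = lin_map J S c p + lin_map J S c q"
  by (auto simp: lin_map_def plus_trop_def distrib_left sum.distrib fun_eq_iff)

lemma lin_map_scale: "lin_map J S c (trop_scale r p) = trop_scale r (lin_map J S c p)"
  by (auto simp: lin_map_def trop_scale_def sum_distrib_left fun_eq_iff mult_ac)

definition finite_coeffs :: "real set \<Rightarrow> 'i set \<Rightarrow> 'i set \<Rightarrow> ('i \<Rightarrow> real) \<Rightarrow> bool" where
  "finite_coeffs R I S c \<longleftrightarrow> finite S \<and> S \<subseteq> I \<and> (\<forall>i\<in>S. c i \<in> R)"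

lemma lin_map_in:
  assumes R: "underlying_ring R" and S: "\<And>j. j \<in> J \<Longrightarrow> finite_coeffs R I (S j) (c j)" and p: "p \<in> trop_group R I"
  shows "lin_map J S c p \<in> trop_group R J"
proof -
  note s = underlying_ringD(1)[OF R]
  have "(\<Sum>i\<in>S j. c j i * expo p i) \<in> R" if "j \<in> J" for j
    using S[OF that] p by (intro is_subring_sum[OF s] is_subringD(4)[OF s]) (auto simp: finite_coeffs_def trop_group_def)
  then show ?thesis by (auto simp: trop_group_def lin_map_def)
qed

lemma topspace_trop_topology: "topspace (trop_topology R I) = trop_group R I"
  by (auto simp: trop_topology_def topspace_pullback_topology trop_group_def)

text \<open>
  Fixing the finitely many coordinates in \<open>S\<close> gives a neighbourhood on which the sum is constant.
\<close>

lemma continuous_map_finite_sum: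
  assumes R: "underlying_ring R" and S: "finite_coeffs R I S c"
  shows "continuous_map (product_topology (\<lambda>_. discrete_topology R) I) (discrete_topology R) (\<lambda>f. \<Sum>i\<in>S. c i * f i)"
  unfolding continuous_map_def
proof (intro conjI allI impI)
  note s = underlying_ringD(1)[OF R]
  show "(\<lambda>f. \<Sum>i\<in>S. c i * f i) \<in> topspace (product_topology (\<lambda>_. discrete_topology R) I) \<rightarrow> topspace (discrete_topology R)"
    using S by (auto intro!: is_subring_sum[OF s] is_subringD(4)[OF s] simp: finite_coeffs_def PiE_iff subset_iff)
next
  fix V assume "openin (discrete_topology R) V"
  show "openin (product_topology (\<lambda>_. discrete_topology R) I)
      {x \<in> topspace (product_topology (\<lambda>_. discrete_topology R) I). (\<Sum>i\<in>S. c i * x i) \<in> V}"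
    unfolding openin_product_topology_alt
  proof (intro ballI)
    fix x assume x: "x \<in> {x \<in> topspace (product_topology (\<lambda>_. discrete_topology R) I). (\<Sum>i\<in>S. c i * x i) \<in> V}"
    define U where "U i = (if i \<in> S then {x i} else R)" for i
    have "finite {i \<in> I. U i \<noteq> topspace (discrete_topology R)}"
      using S by (auto simp: U_def finite_coeffs_def intro: finite_subset[of _ S])
    moreover have "openin (discrete_topology R) (U i)" if "i \<in> I" for i
      using x that by (auto simp: U_def PiE_iff)
    moreover have "x \<in> Pi\<^sub>E I U" using x by (auto simp: U_def PiE_iff)
    moreover have "y \<in> topspace (product_topology (\<lambda>_. discrete_topology R) I) \<and> (\<Sum>i\<in>S. c i * y i) \<in> V"
      if y: "y \<in> Pi\<^sub>E I U" for y
    proof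
      have "y i \<in> R" if "i \<in> I" for i
        using y x that by (cases "i \<in> S") (force simp: U_def PiE_iff)+
      then show "y \<in> topspace (product_topology (\<lambda>_. discrete_topology R) I)"
        using y by (auto simp: PiE_iff)
      have "y i = x i" if "i \<in> S" for i
        using y S that by (fastforce simp: U_def PiE_iff finite_coeffs_def)
      then show "(\<Sum>i\<in>S. c i * y i) \<in> V" using x by simp
    qed
    ultimately show "\<exists>U. finite {i \<in> I. U i \<noteq> topspace (discrete_topology R)} \<and> (\<forall>i\<in>I. openin (discrete_topology R) (U i)) \<and>
        x \<in> Pi\<^sub>E I U \<and> Pi\<^sub>E I U \<subseteq> {x \<in> topspace (product_topology (\<lambda>_. discrete_topology R) I). (\<Sum>i\<in>S. c i * x i) \<in> V}"
      by blast
  qed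
qed

lemma continuous_map_lin_map:
  assumes R: "underlying_ring R" and S: "\<And>j. j \<in> J \<Longrightarrow> finite_coeffs R I (S j) (c j)"
  shows "continuous_map (trop_topology R I) (trop_topology R J) (lin_map J S c)"
  unfolding trop_topology_def[of R J]
proof (rule continuous_map_pullback')
  show "topspace (trop_topology R I) \<subseteq> lin_map J S c -` trop_group R J"
    using lin_map_in[OF R S] by (auto simp: topspace_trop_topology)
  have "continuous_map (trop_topology R I) (discrete_topology R) (\<lambda>p. restrict (expo (lin_map J S c p)) J j)"
    if j: "j \<in> J" for j
  proof -
    have "continuous_map (trop_topology R I) (discrete_topology R)
        ((\<lambda>f. \<Sum>i\<in>S j. c j i * f i) \<circ> (\<lambda>p. restrict (expo p) I))"
      unfolding trop_topology_def by (intro continuous_map_pullback continuous_map_finite_sum R S j)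
    moreover have "(\<lambda>f. \<Sum>i\<in>S j. c j i * f i) \<circ> (\<lambda>p. restrict (expo p) I) =
        (\<lambda>p. restrict (expo (lin_map J S c p)) J j)"
      using S[OF j] j by (auto simp: fun_eq_iff lin_map_def finite_coeffs_def subset_iff intro!: sum.cong)
    ultimately show ?thesis by simp
  qed
  then show "continuous_map (trop_topology R I) (product_topology (\<lambda>_. discrete_topology R) J)
      ((\<lambda>p. restrict (expo p) J) \<circ> lin_map J S c)"
    by (auto simp: continuous_map_componentwise)
qed

text \<open>
  The kernel of the \<open>j\<close>-th component is open because \<open>R\<close> is discrete, so it contains a basic
  neighbourhood of 0, which constrains the exponents in a finite set \<open>S\<close> only.  Exponents outside \<open>S\<close>
  therefore do not matter, and on the others the component is given by its values on the unit vectors.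
\<close>

lemma continuous_linear_component:
  assumes R: "underlying_ring R" and lin: "R_linear R I \<theta>" and im: "\<theta> \<in> trop_group R I \<rightarrow> trop_group R J"
    and cont: "continuous_map (trop_topology R I) (trop_topology R J) \<theta>" and j: "j \<in> J"
  shows "\<exists>S c. finite_coeffs R I S c \<and> (\<forall>p\<in>trop_group R I. expo (\<theta> p) j = (\<Sum>i\<in>S. c i * expo p i))"
proof -
  let ?G = "trop_group R I" and ?P = "\<lambda>I. product_topology (\<lambda>_. discrete_topology R) I"
  note s = underlying_ringD(1)[OF R] and s' = is_subringD[OF underlying_ringD(1)[OF R]]
  have add: "\<theta> (p + q) = \<theta> p + \<theta> q" if "p \<in> ?G" "q \<in> ?G" for p q using lin that by (auto simp: R_linear_def)
  have scale: "\<theta> (trop_scale r p) = trop_scale r (\<theta> p)" if "p \<in> ?G" "r \<in> R" for p r using lin that by (auto simp: R_linear_def)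
  have zero_in: "0 \<in> ?G" by (rule trop_group_0[OF R])
  have zero: "\<theta> 0 = 0" using add[OF zero_in zero_in] by simp
  have sum_in: "(\<Sum>x\<in>A. f x) \<in> ?G" if "\<And>x. x \<in> A \<Longrightarrow> f x \<in> ?G" for A :: "'a set" and f
    using that by (induction A rule: infinite_finite_induct) (auto simp: zero_in trop_group_add[OF R])
  have sum: "\<theta> (\<Sum>x\<in>A. f x) = (\<Sum>x\<in>A. \<theta> (f x))" if "\<And>x. x \<in> A \<Longrightarrow> f x \<in> ?G" for A :: "'a set" and f
    using that by (induction A rule: infinite_finite_induct) (auto simp: zero add sum_in)
  \<comment> \<open>the kernel of the \<open>j\<close>-th component, as the preimage of the exponent 0\<close>
  have "openin (?P J) {f \<in> topspace (?P J). f j \<in> {0}}"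
    by (rule openin_continuous_map_preimage[of "?P J" "discrete_topology R"])
       (use j s' in \<open>auto intro: continuous_map_product_projection\<close>)
  then have "openin (trop_topology R J) ((\<lambda>p. restrict (expo p) J) -` {f \<in> topspace (?P J). f j \<in> {0}} \<inter> trop_group R J)"
    unfolding trop_topology_def openin_pullback_topology by blast
  from openin_continuous_map_preimage[OF cont this]
  obtain U where U: "openin (?P I) U"
    "{p \<in> ?G. \<theta> p \<in> (\<lambda>p. restrict (expo p) J) -` {f \<in> topspace (?P J). f j \<in> {0}} \<inter> trop_group R J} = (\<lambda>p. restrict (expo p) I) -` U \<inter> ?G"
    unfolding topspace_trop_topology by (auto simp: trop_topology_def openin_pullback_topology)
  have "\<theta> p \<in> (\<lambda>p. restrict (expo p) J) -` {f \<in> topspace (?P J). f j \<in> {0}} \<inter> trop_group R J \<longleftrightarrow> expo (\<theta> p) j = 0"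
    if "p \<in> ?G" for p
    using im that j by (auto simp: trop_group_def)
  then have ker: "expo (\<theta> p) j = 0 \<longleftrightarrow> restrict (expo p) I \<in> U" if "p \<in> ?G" for p
    using U(2) that by blast
  have "restrict (expo 0) I \<in> U" using ker[OF zero_in] zero by (simp add: expo_simps)
  then obtain V where V: "finite {i \<in> I. V i \<noteq> R}" "restrict (expo 0) I \<in> Pi\<^sub>E I V" "Pi\<^sub>E I V \<subseteq> U"
    using U(1) unfolding openin_product_topology_alt by auto
  define S where "S = {i \<in> I. V i \<noteq> R}"
  have vanish: "expo (\<theta> p) j = 0" if p: "p \<in> ?G" "\<And>i. i \<in> S \<Longrightarrow> expo p i = 0" for p
  proof -
    have "expo p i \<in> V i" if "i \<in> I" for i
      using V(2) p that by (cases "i \<in> S") (auto simp: S_def PiE_iff trop_group_def expo_simps)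
    then have "restrict (expo p) I \<in> U" using V(3) by auto
    then show ?thesis using ker[OF p(1)] by blast
  qed
  define e where "e i = Trop (\<lambda>k. if k = i then 1 else 0)" for i :: 'a
  have e: "e i \<in> ?G" if "i \<in> I" for i using that s' by (auto simp: e_def trop_group_def)
  define c where "c i = expo (\<theta> (e i)) j" for i
  have "finite_coeffs R I S c"
    using V(1) im e j by (auto simp: finite_coeffs_def S_def c_def trop_group_def Pi_iff)
  moreover have "expo (\<theta> p) j = (\<Sum>i\<in>S. c i * expo p i)" if p: "p \<in> ?G" for p
  proof -
    have pR: "expo p i \<in> R" if "i \<in> I" for i using p that by (auto simp: trop_group_def)
    have pi: "trop_scale (expo p i) (e i) \<in> ?G" if "i \<in> S" for i
      using e[of i] pR[of i] that s' by (auto simp: S_def trop_group_def expo_simps)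
    define q where "q = (\<Sum>i\<in>S. trop_scale (expo p i) (e i))"
    have q: "q \<in> ?G" unfolding q_def by (rule sum_in[OF pi])
    have d: "p - q \<in> ?G" using p q s' by (auto simp: trop_group_def expo_simps)
    have "expo q i = expo p i" if "i \<in> S" for i
      using that V(1) by (simp add: q_def expo_sum expo_simps e_def S_def if_distrib sum.delta' cong: if_cong)
    then have "expo (\<theta> (p - q)) j = 0" by (intro vanish d) (simp add: expo_simps)
    moreover have "\<theta> p = \<theta> (p - q) + \<theta> q" using add[OF d q] by simp
    ultimately have "expo (\<theta> p) j = expo (\<theta> q) j" by (simp add: expo_simps)
    also have "\<theta> q = (\<Sum>i\<in>S. \<theta> (trop_scale (expo p i) (e i)))" unfolding q_def by (rule sum[OF pi])
    also have "\<dots> = (\<Sum>i\<in>S. trop_scale (expo p i) (\<theta> (e i)))"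
      by (intro sum.cong refl scale e pR) (auto simp: S_def)
    also have "expo \<dots> j = (\<Sum>i\<in>S. c i * expo p i)" by (simp add: expo_sum expo_simps c_def mult.commute)
    finally show ?thesis .
  qed
  ultimately show ?thesis by blast
qed

section \<open>Coherent combinations of rows\<close>

text \<open>
  The formal expression ``\<open>a\<close> minus the combination'' is \<open>B\<close>-coherent, with \<open>a\<close> moved to the other side.
\<close>

definition coherent_sum ::
  "nat \<Rightarrow> (nat \<Rightarrow> nat \<Rightarrow> int) \<Rightarrow> 's set \<Rightarrow> ('s \<Rightarrow> real) \<Rightarrow> ('s \<Rightarrow> nat \<Rightarrow> real) \<Rightarrow> (nat \<Rightarrow> real) \<Rightarrow> bool" where
  "coherent_sum n B S c v a \<longleftrightarrow>
     (\<forall>ks. set ks \<subseteq> {1..n} \<longrightarrow> (\<forall>j\<in>{1..n}.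
        (\<Sum>i\<in>S. c i * eta_seq B ks (v i) j) = eta_seq B ks a j \<and>
        (\<Sum>i\<in>S. c i * min (eta_seq B ks (v i) j) 0) = min (eta_seq B ks a j) 0))"

lemma B_coherent_minus_sum:
  assumes "finite S"
  shows "B_coherent n B (insert None (Some ` S)) (case_option 1 (\<lambda>i. - c i)) (case_option a v) \<longleftrightarrow>
    coherent_sum n B S c v a"
proof -
  have "(\<Sum>i\<in>insert None (Some ` S). case_option 1 (\<lambda>i. - c i) i * f (case_option a v i)) = 0 \<longleftrightarrow>
      (\<Sum>i\<in>S. c i * f (v i)) = f a" for f :: "(nat \<Rightarrow> real) \<Rightarrow> real"
    using assms by (subst sum.insert) (auto simp: sum.reindex sum_negf)
  note * = this[of "\<lambda>u. eta_seq B _ u _"] this[of "\<lambda>u. min (eta_seq B _ u _) 0"]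
  show ?thesis
    unfolding B_coherent_def coherent_sum_def * ..
qed

lemma eta_seq_0: "eta_seq B ks (\<lambda>_. 0) = (\<lambda>_. 0)"
  by (induction ks) (auto simp: eta_def)

lemma coherent_sum_0: "coherent_sum n B S c v (\<lambda>_. 0) \<longleftrightarrow> B_coherent n B S c v"
  by (simp add: coherent_sum_def B_coherent_def eta_seq_0)

lemma coherent_sumI:
  assumes "\<And>t l. t \<in> tree_vertices n \<Longrightarrow> l \<in> {1..n} \<Longrightarrow>
      (\<Sum>i\<in>S. c i * eta_seq B t (v i) l) = eta_seq B t a l \<and>
      (\<Sum>i\<in>S. c i * min (eta_seq B t (v i) l) 0) = min (eta_seq B t a l) 0"
  shows "coherent_sum n B S c v a"
  unfolding coherent_sum_def
proof (intro allI impI ballI)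
  fix ks j assume ks: "set ks \<subseteq> {1..n}" and j: "j \<in> {1..n}"
  obtain t where t: "distinct_adj t" "set t \<subseteq> set ks" "eta_seq B t = eta_seq B ks"
    using reduced_word by metis
  then have "t \<in> tree_vertices n" using ks by (auto simp: tree_vertices_def)
  from assms[OF this j] show "(\<Sum>i\<in>S. c i * eta_seq B ks (v i) j) = eta_seq B ks a j \<and>
      (\<Sum>i\<in>S. c i * min (eta_seq B ks (v i) j) 0) = min (eta_seq B ks a j) 0"
    by (simp only: t(3))
qed

text \<open>
  The difference of two coherent expansions of the same vector is a coherent relation, supported on the
  union of the two index sets, so its coefficients vanish.
\<close>

lemma coherent_sum_unique:
  assumes R: "underlying_ring R" and basis: "R_basis R n B I b"
    and S: "finite_coeffs R I S c" "coherent_sum n B S c b a"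
    and S': "finite_coeffs R I S' c'" "coherent_sum n B S' c' b a"
  shows "(\<Sum>i\<in>S. c i * f i) = (\<Sum>i\<in>S'. c' i * f i)"
proof -
  note s = is_subringD[OF underlying_ringD(1)[OF R]]
  \<comment> \<open>\<open>c\<close> and \<open>c'\<close> may be nonzero outside \<open>S\<close> and \<open>S'\<close>, so they are cut off before subtracting\<close>
  define d where "d i = (if i \<in> S then c i else 0) - (if i \<in> S' then c' i else 0)" for i
  have fin: "finite S" "finite S'" using S S' by (auto simp: finite_coeffs_def)
  have sum: "(\<Sum>i\<in>S \<union> S'. d i * g i) = (\<Sum>i\<in>S. c i * g i) - (\<Sum>i\<in>S'. c' i * g i)" for g
  proof -
    have 1: "(\<Sum>i\<in>S \<union> S'. (if i \<in> S then c i else 0) * g i) = (\<Sum>i\<in>S. c i * g i)"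
      by (rule sum.mono_neutral_cong_right) (use fin in auto)
    have 2: "(\<Sum>i\<in>S \<union> S'. (if i \<in> S' then c' i else 0) * g i) = (\<Sum>i\<in>S'. c' i * g i)"
      by (rule sum.mono_neutral_cong_right) (use fin in auto)
    show ?thesis by (simp only: d_def left_diff_distrib sum_subtractf 1 2)
  qed
  have "B_coherent n B (S \<union> S') d b"
    using S(2) S'(2) by (simp add: B_coherent_def coherent_sum_def sum)
  moreover have "finite (S \<union> S')" "S \<union> S' \<subseteq> I" "\<forall>i\<in>S \<union> S'. d i \<in> R"
    using S(1) S'(1) s by (auto simp: finite_coeffs_def d_def)
  ultimately have "\<forall>i\<in>S \<union> S'. d i = 0"
    using basis[unfolded R_basis_def, THEN conjunct2, THEN conjunct2, rule_format, of "S \<union> S'" d]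
    by simp
  then have "(\<Sum>i\<in>S \<union> S'. d i * f i) = 0" by (intro sum.neutral) auto
  then show ?thesis by (simp add: sum)
qed

text \<open>
  Compatibility of a linear map with the coefficients at \<open>t\<close> amounts, row by row in the target, to
  the two equations of coherence for the sequence \<open>t\<close>.
\<close>

lemma lin_map_coeff_at:
  assumes same: "same_exchange_matrix n (B, b) (B', b')" and S: "\<forall>j\<in>J. S j \<subseteq> I"
    and t: "set t \<subseteq> {1..n}" and l: "l \<in> {1..n}"
  shows "lin_map J S c (coeff_at n I (x, (B, b)) t l) = coeff_at n J (x', (B', b')) t l \<longleftrightarrow>
      (\<forall>j\<in>J. (\<Sum>i\<in>S j. c j i * eta_seq B t (b i) l) = eta_seq B t (b' j) l)" (is ?A)
    and "lin_map J S c (trop_oplus (coeff_at n I (x, (B, b)) t l) 0) = trop_oplus (coeff_at n J (x', (B', b')) t l) 0 \<longleftrightarrow>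
      (\<forall>j\<in>J. (\<Sum>i\<in>S j. c j i * min (eta_seq B t (b i) l) 0) = min (eta_seq B t (b' j) l) 0)" (is ?B)
proof -
  have eq: "eta_seq B' t a l = eta_seq B t a l" for a
    by (rule eta_seq_cong[OF _ t l]) (use same in \<open>auto simp: same_exchange_matrix_def\<close>)
  have sum: "(\<Sum>i\<in>S j. c j i * (if i \<in> I then f i else 0)) = (\<Sum>i\<in>S j. c j i * f i)" if "j \<in> J" for j f
  proof -
    have "S j \<subseteq> I" using S that by blast
    then show ?thesis by (auto intro!: sum.cong)
  qed
  show ?A
    unfolding coeff_at_eq lin_map_def eq
    by (auto simp: fun_eq_iff sum cong: if_cong)
  have min: "(\<lambda>i. min (if i \<in> K then f i else 0) 0) = (\<lambda>i. if i \<in> K then min (f i) (0::real) else 0)"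
    for K :: "'x set" and f by auto
  show ?B
    unfolding coeff_at_eq lin_map_def eq trop_oplus_def zero_trop_def trop.sel min
    by (auto simp: fun_eq_iff sum cong: if_cong)
qed

section \<open>Coefficient specializations\<close>

lemma cluster_algebra_props:
  shows "is_subring (cluster_algebra R n I \<Sigma>)"
    "a \<in> group_ring_Z R I \<Longrightarrow> const a \<in> cluster_algebra R n I \<Sigma>"
    "p \<in> trop_group R I \<Longrightarrow> trop_emb p \<in> cluster_algebra R n I \<Sigma>"
    "t \<in> tree_vertices n \<Longrightarrow> j \<in> {1..n} \<Longrightarrow> cluster_var n I \<Sigma> t j \<in> cluster_algebra R n I \<Sigma>"
proof -
  show "is_subring (cluster_algebra R n I \<Sigma>)" unfolding cluster_algebra_def by (rule is_subring_hull)
  show c: "const a \<in> cluster_algebra R n I \<Sigma>" if "a \<in> group_ring_Z R I" for a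
    unfolding cluster_algebra_def by (rule hull_inc) (use that in auto)
  show "trop_emb p \<in> cluster_algebra R n I \<Sigma>" if "p \<in> trop_group R I"
    unfolding trop_emb_def by (rule c[OF trop_emb_in_group_ring[OF that]])
  show "cluster_var n I \<Sigma> t j \<in> cluster_algebra R n I \<Sigma>" if "t \<in> tree_vertices n" "j \<in> {1..n}"
    unfolding cluster_algebra_def by (rule hull_inc) (use that in auto)
qed

lemma tree_vertices_Nil: "[] \<in> tree_vertices n"
  by (simp add: tree_vertices_def)

lemma tree_vertices_ConsD:
  "k # t \<in> tree_vertices n \<Longrightarrow> k \<in> {1..n} \<and> t \<in> tree_vertices n"
  by (auto simp: tree_vertices_def dest: distinct_adj_ConsD)

text \<open>
  An exchange relation can be solved for the new cluster variable also after applying \<open>\<phi>\<close>, because the image of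
  the old one is a cluster variable of the target and hence nonzero.
\<close>

lemma specialization_cluster_var:
  assumes R: "underlying_ring R"
    and seeds: "is_seed R n I (x, (B, b))" "is_seed R n J (x', (B', b'))"
    and sp: "coefficient_specialization R n I (x, (B, b)) J (x', (B', b')) \<phi>"
    and t: "t \<in> tree_vertices n" and j: "j \<in> {1..n}"
  shows "\<phi> (cluster_var n I (x, (B, b)) t j) = cluster_var n J (x', (B', b')) t j"
  using t j
proof (induction t arbitrary: j)
  case Nil
  then show ?case using sp by (simp add: cluster_var_Nil coefficient_specialization_def)
next
  case (Cons k t)
  have k: "k \<in> {1..n}" and t: "t \<in> tree_vertices n" using tree_vertices_ConsD[OF Cons.prems(1)] by auto
  have t': "set t \<subseteq> {1..n}" using t by (auto simp: tree_vertices_def)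
  have ext: "extended_exchange_matrix R n I (B, b)" using seeds by (simp add: is_seed_def)
  note IH = Cons.IH[OF t]
  show ?case
  proof (cases "j = k")
    case True
    let ?A = "cluster_algebra R n I (x, (B, b))"
    let ?x = "cluster_var n I (x, (B, b)) t" and ?x' = "cluster_var n J (x', (B', b')) t"
    let ?y = "coeff_at n I (x, (B, b)) t k" and ?y' = "coeff_at n J (x', (B', b')) t k"
    have hom: "ring_hom_on ?A (cluster_algebra R n J (x', (B', b'))) \<phi>"
      and y: "\<phi> (trop_emb ?y) = trop_emb ?y'"
      and z: "\<phi> (trop_emb (trop_oplus ?y 0)) = trop_emb (trop_oplus ?y' 0)"
      using sp t k by (auto simp: coefficient_specialization_def)
    have in_A: "exchange n (mutate_seq B t) k ?x (trop_emb ?y) (trop_emb (trop_oplus ?y 0)) \<in> ?A"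
      using cluster_algebra_props(4)[OF Cons.prems(1) k, of I "(x, (B, b))" R] by (simp add: cluster_var_Cons)
    have nz: "\<phi> (?x k) \<noteq> 0" "\<phi> (trop_emb (trop_oplus ?y 0)) \<noteq> 0"
      unfolding IH[OF k] z using cluster_var_nonzero[OF R seeds(2) t' k] by (auto simp: trop_emb_nonzero)
    have "\<phi> (cluster_var n I (x, (B, b)) (k # t) k) =
        exchange n (mutate_seq B t) k (\<lambda>i. \<phi> (?x i)) (trop_emb ?y') (trop_emb (trop_oplus ?y' 0))"
      unfolding cluster_var_Cons if_P[OF refl] y[symmetric] z[symmetric]
      by (rule ring_hom_on_exchange[where x = ?x and z = "trop_emb (trop_oplus ?y 0)",
            OF hom cluster_algebra_props(1) in_A cluster_algebra_props(4)[OF t] k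
              cluster_algebra_props(3)[OF coeff_at_in(1)[OF R ext t' k]]
              cluster_algebra_props(3)[OF coeff_at_in(2)[OF R ext t' k]] nz])
    also have "\<dots> = exchange n (mutate_seq B' t) k ?x' (trop_emb ?y') (trop_emb (trop_oplus ?y' 0))"
    proof (rule exchange_cong[OF _ IH k])
      fix i assume i: "i \<in> {1..n}"
      show "mutate_seq B t i k = mutate_seq B' t i k"
        by (rule mutate_seq_cong[OF _ t' i k]) (use sp in \<open>auto simp: coefficient_specialization_def same_exchange_matrix_def\<close>)
    qed
    also have "\<dots> = cluster_var n J (x', (B', b')) (k # t) k"
      by (simp add: cluster_var_Cons)
    finally show ?thesis using True by simp
  next
    case False
    then show ?thesis using IH[OF Cons.prems(2)] by (simp add: cluster_var_Cons)
  qed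
qed

text \<open>
  The elements on which two specializations agree form a subring, and the generators of the cluster
  algebra belong to it: scalars are integer combinations of formal products, and the images of the
  cluster variables are known.
\<close>

lemma specialization_determined:
  assumes R: "underlying_ring R"
    and seeds: "is_seed R n I (x, (B, b))" "is_seed R n J (x', (B', b'))"
    and sp: "coefficient_specialization R n I (x, (B, b)) J (x', (B', b')) \<phi>"
      "coefficient_specialization R n I (x, (B, b)) J (x', (B', b')) \<phi>'"
    and ext: "\<phi> \<in> extensional (cluster_algebra R n I (x, (B, b)))" "\<phi>' \<in> extensional (cluster_algebra R n I (x, (B, b)))"
    and eq: "\<And>p. p \<in> trop_group R I \<Longrightarrow> \<phi> (trop_emb p) = \<phi>' (trop_emb p)"
  shows "\<phi> = \<phi>'"
proof -
  let ?A = "cluster_algebra R n I (x, (B, b))"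
  define E where "E = {z \<in> ?A. \<phi> z = \<phi>' z}"
  note A = cluster_algebra_props(1)[of R n I "(x, (B, b))"]
  have hom: "ring_hom_on ?A (cluster_algebra R n J (x', (B', b'))) \<phi>"
    "ring_hom_on ?A (cluster_algebra R n J (x', (B', b'))) \<phi>'"
    using sp by (auto simp: coefficient_specialization_def)
  note h = ring_hom_onD[OF hom(1) A] and h' = ring_hom_onD[OF hom(2) A] and A' = is_subringD[OF A]
  have E: "is_subring E" unfolding is_subring_def E_def by (auto simp: A' h h')
  note E' = is_subringD[OF E]
  have nat: "of_nat m \<in> E" for m by (induction m) (auto simp: E')
  have int: "of_int m \<in> E" for m by (cases m) (auto simp: E' nat simp del: of_nat_Suc)
  have emb: "trop_emb p \<in> E" if "p \<in> trop_group R I" for p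
    using eq[OF that] cluster_algebra_props(3)[OF that] by (auto simp: E_def)
  have "const a \<in> E" if a: "a \<in> group_ring_Z R I" for a
  proof -
    have "const a = (\<Sum>p\<in>Poly_Mapping.keys a. const (Poly_Mapping.single p (Poly_Mapping.lookup a p)))"
      by (subst sum_monos[of a, symmetric]) (simp add: ring_map_sum[OF ring_map_const] del: sum_monos)
    also have "\<dots> \<in> E"
    proof (rule is_subring_sum[OF E])
      fix p assume p: "p \<in> Poly_Mapping.keys a"
      obtain m where m: "Poly_Mapping.lookup a p = of_int m" using a by (auto simp: group_ring_Z_def elim: Ints_cases)
      have "Poly_Mapping.single p (Poly_Mapping.lookup a p) = of_int m * Poly_Mapping.single p 1"
        by (simp add: m mult_single flip: single_of_int)
      then have "const (Poly_Mapping.single p (Poly_Mapping.lookup a p)) = of_int m * trop_emb p"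
        by (simp only: ring_mapD(4)[OF ring_map_const] ring_map_of_int[OF ring_map_const] trop_emb_def)
      moreover have "p \<in> trop_group R I" using a p by (auto simp: group_ring_Z_def group_ring_Q_def)
      ultimately show "const (Poly_Mapping.single p (Poly_Mapping.lookup a p)) \<in> E"
        using int emb E'(4) by simp
    qed
    finally show ?thesis .
  qed
  moreover have "cluster_var n I (x, (B, b)) t j \<in> E" if "t \<in> tree_vertices n" "j \<in> {1..n}" for t j
    using specialization_cluster_var[OF R seeds sp(1) that] specialization_cluster_var[OF R seeds sp(2) that]
      cluster_algebra_props(4)[OF that] by (simp add: E_def)
  ultimately have "?A \<subseteq> E"
    unfolding cluster_algebra_def by (intro hull_minimal E) auto
  then have "\<phi> z = \<phi>' z" if "z \<in> ?A" for z using that by (auto simp: E_def)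
  then show ?thesis using ext by (rule extensionalityI[rotated 2])
qed

text \<open>
  Evaluate the first seed in the ambient field of the second one, sending formal products through
  \<open>lin_map J S c\<close> and \<open>x j\<close> to \<open>x' j\<close>.  The evaluation is defined on a local ring only, but this
  ring contains the cluster algebra: along the tree, one divides by elements whose
  images are cluster variables or units of the target, hence nonzero.
\<close>

lemma specialization_exists:
  assumes R: "underlying_ring R"
    and seeds: "is_seed R n I (x, (B, b))" "is_seed R n J (x', (B', b'))"
    and same: "same_exchange_matrix n (B, b) (B', b')"
    and S: "\<And>j. j \<in> J \<Longrightarrow> finite_coeffs R I (S j) (c j)"
    and coh: "\<And>j. j \<in> J \<Longrightarrow> coherent_sum n B (S j) (c j) b (b' j)"
  shows "\<exists>\<phi>. \<phi> \<in> extensional (cluster_algebra R n I (x, (B, b))) \<and>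
    coefficient_specialization R n I (x, (B, b)) J (x', (B', b')) \<phi> \<and>
    (\<forall>p\<in>trop_group R I. \<phi> (trop_emb p) = trop_emb (lin_map J S c p))"
proof -
  let ?A = "cluster_algebra R n I (x, (B, b))" and ?A' = "cluster_algebra R n J (x', (B', b'))"
  let ?X = "cluster_var n I (x, (B, b))" and ?X' = "cluster_var n J (x', (B', b'))"
  let ?Y = "coeff_at n I (x, (B, b))" and ?Y' = "coeff_at n J (x', (B', b'))"
  let ?\<theta> = "lin_map J S c"
  define rat :: "rat \<Rightarrow> 'b ratfun" where "rat r = const (Poly_Mapping.single 0 r)" for r
  have ext: "extended_exchange_matrix R n I (B, b)" using seeds by (simp add: is_seed_def)
  have rat: "ring_map rat"
    using ring_mapD[OF ring_map_const] by (auto simp: ring_map_def rat_def single_add mult_single single_one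
      simp flip: ring_mapD(4)[OF ring_map_const])
  obtain L and \<Psi> :: "'a ratfun \<Rightarrow> 'b ratfun" where L: "local_hom L \<Psi>"
    "\<And>a. a \<in> group_ring_Q R I \<Longrightarrow> const a \<in> L"
    "\<And>a. a \<in> group_ring_Q R I \<Longrightarrow> \<Psi> (const a) = monoid_ring_eval rat (\<lambda>p. trop_emb (?\<theta> p)) a"
    "\<And>j. j \<in> {1..n} \<Longrightarrow> x j \<in> L" "\<And>j. j \<in> {1..n} \<Longrightarrow> \<Psi> (x j) = x' j"
    by (rule seed_evaluation[OF R seeds(1) rat, of "\<lambda>p. trop_emb (?\<theta> p)" x'])
      (auto simp: lin_map_0 trop_emb_0 lin_map_add trop_emb_add)
  have sL: "is_subring L" and hL: "ring_hom_on L UNIV \<Psi>" using L(1) by (auto simp: local_hom_def)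
  have emb: "trop_emb p \<in> L" "\<Psi> (trop_emb p) = trop_emb (?\<theta> p)" if "p \<in> trop_group R I" for p
    using trop_emb_in_group_ring[OF that] L(2,3)[of "Poly_Mapping.single p 1"]
    by (auto simp: trop_emb_def group_ring_Z_def monoid_ring_eval_single ring_mapD[OF rat])
  have \<theta>_in: "?\<theta> p \<in> trop_group R J" if "p \<in> trop_group R I" for p
    by (rule lin_map_in[OF R S that])
  have SI: "\<forall>j\<in>J. S j \<subseteq> I" using S by (auto simp: finite_coeffs_def)
  have \<theta>: "?\<theta> (?Y t l) = ?Y' t l" "?\<theta> (trop_oplus (?Y t l) 0) = trop_oplus (?Y' t l) 0"
    if "set t \<subseteq> {1..n}" "l \<in> {1..n}" for t l
    using coh that unfolding lin_map_coeff_at[OF same SI that] by (auto simp: coherent_sum_def)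
  have coeffs: "trop_emb (?Y t l) \<in> L" "\<Psi> (trop_emb (?Y t l)) = trop_emb (?Y' t l)"
    "trop_emb (trop_oplus (?Y t l) 0) \<in> L" "\<Psi> (trop_emb (trop_oplus (?Y t l) 0)) = trop_emb (trop_oplus (?Y' t l) 0)"
    if "set t \<subseteq> {1..n}" "l \<in> {1..n}" for t l
    using emb[OF coeff_at_in(1)[OF R ext that]] emb[OF coeff_at_in(2)[OF R ext that]] \<theta>[OF that] by auto
  have vars: "?X t j \<in> L \<and> \<Psi> (?X t j) = ?X' t j" if "set t \<subseteq> {1..n}" "j \<in> {1..n}" for t j
    using that
  proof (induction t arbitrary: j)
    case Nil
    then show ?case using L by (simp add: cluster_var_Nil)
  next
    case (Cons k t)
    have k: "k \<in> {1..n}" and t: "set t \<subseteq> {1..n}" using Cons.prems by auto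
    note IH = Cons.IH[OF t]
    show ?case
    proof (cases "j = k")
      case True
      have "\<Psi> (?X t k) \<noteq> 0" "\<Psi> (trop_emb (trop_oplus (?Y t k) 0)) \<noteq> 0"
        using IH[OF k] cluster_var_nonzero[OF R seeds(2) t k] by (auto simp: coeffs[OF t k] trop_emb_nonzero)
      note * = local_hom_exchange[where x = "?X t" and B = "mutate_seq B t", OF L(1) conjunct1[OF IH] k coeffs(1,3)[OF t k] this,
          unfolded coeffs[OF t k]]
      have "exchange n (mutate_seq B t) k (\<lambda>i. \<Psi> (?X t i)) (trop_emb (?Y' t k)) (trop_emb (trop_oplus (?Y' t k) 0)) =
          exchange n (mutate_seq B' t) k (?X' t) (trop_emb (?Y' t k)) (trop_emb (trop_oplus (?Y' t k) 0))"
      proof (rule exchange_cong[OF _ conjunct2[OF IH] k])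
        fix i assume i: "i \<in> {1..n}"
        show "mutate_seq B t i k = mutate_seq B' t i k"
          by (rule mutate_seq_cong[OF _ t i k]) (use same in \<open>auto simp: same_exchange_matrix_def\<close>)
      qed
      then show ?thesis using True * by (simp add: cluster_var_Cons)
    next
      case False
      then show ?thesis using IH[OF Cons.prems(2)] by (simp add: cluster_var_Cons)
    qed
  qed
  have scalars: "\<Psi> (const a) \<in> ?A'" if a: "a \<in> group_ring_Z R I" for a
  proof -
    have "\<Psi> (const a) = (\<Sum>p\<in>Poly_Mapping.keys a. rat (Poly_Mapping.lookup a p) * trop_emb (?\<theta> p))"
      using L(3) a by (simp add: group_ring_Z_def monoid_ring_eval_def)
    also have "\<dots> \<in> ?A'"
    proof (rule is_subring_sum[OF cluster_algebra_props(1)])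
      fix p assume p: "p \<in> Poly_Mapping.keys a"
      have "rat (Poly_Mapping.lookup a p) * trop_emb (?\<theta> p) = const (Poly_Mapping.single (?\<theta> p) (Poly_Mapping.lookup a p))"
        by (simp add: rat_def trop_emb_def mult_single flip: ring_mapD(4)[OF ring_map_const])
      also have "\<dots> \<in> ?A'"
        using a p \<theta>_in by (intro cluster_algebra_props(2))
          (auto simp: group_ring_Z_def group_ring_Q_def lookup_single when_def)
      finally show "rat (Poly_Mapping.lookup a p) * trop_emb (?\<theta> p) \<in> ?A'" .
    qed
    finally show ?thesis .
  qed
  have tv: "set t \<subseteq> {1..n}" if "t \<in> tree_vertices n" for t using that by (auto simp: tree_vertices_def)
  have "?A \<subseteq> {z \<in> L. \<Psi> z \<in> ?A'}"
    unfolding cluster_algebra_def[of R n I]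
  proof (rule hull_minimal)
    show "is_subring {z \<in> L. \<Psi> z \<in> ?A'}"
      unfolding is_subring_def
      using is_subringD[OF sL] ring_hom_onD[OF hL sL] is_subringD[OF cluster_algebra_props(1)[of R n J "(x', (B', b'))"]]
      by auto
    show "const ` group_ring_Z R I \<union> {?X t j |t j. t \<in> tree_vertices n \<and> j \<in> {1..n}} \<subseteq> {z \<in> L. \<Psi> z \<in> ?A'}"
      using L(2) scalars vars[OF tv] cluster_algebra_props(4)[of _ n _ J "(x', (B', b'))" R] by (fastforce simp: group_ring_Z_def)
  qed
  then have AL: "z \<in> L" "\<Psi> z \<in> ?A'" if "z \<in> ?A" for z using that by auto
  define \<phi> where "\<phi> = restrict \<Psi> ?A"
  have \<phi>: "\<phi> z = \<Psi> z" if "z \<in> ?A" for z using that by (simp add: \<phi>_def)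
  note A = is_subringD[OF cluster_algebra_props(1)[of R n I "(x, (B, b))"]]
  have hom: "ring_hom_on ?A ?A' \<phi>"
    unfolding ring_hom_on_def using A AL ring_hom_onD[OF hL sL] by (auto simp: \<phi>)
  have \<phi>emb: "\<phi> (trop_emb p) = trop_emb (?\<theta> p)" if "p \<in> trop_group R I" for p
    using emb[OF that] cluster_algebra_props(3)[OF that] by (simp add: \<phi>)
  have "\<phi> (x j) = x' j" if "j \<in> {1..n}" for j
    using L(5)[OF that] cluster_algebra_props(4)[OF tree_vertices_Nil that, of I "(x, (B, b))" R]
    by (simp add: cluster_var_Nil \<phi>)
  moreover have "?\<theta> \<in> trop_group R I \<rightarrow> trop_group R J" using \<theta>_in by auto
  moreover have "R_linear R I ?\<theta>" by (simp add: R_linear_def lin_map_add lin_map_scale)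
  moreover have "continuous_map (trop_topology R I) (trop_topology R J) ?\<theta>"
    by (rule continuous_map_lin_map[OF R S])
  moreover have "\<phi> (trop_emb (?Y t l)) = trop_emb (?Y' t l) \<and>
      \<phi> (trop_emb (trop_oplus (?Y t l) 0)) = trop_emb (trop_oplus (?Y' t l) 0)"
    if "t \<in> tree_vertices n" "l \<in> {1..n}" for t l
    using \<phi>emb coeff_at_in[OF R ext tv[OF that(1)] that(2)] \<theta>[OF tv[OF that(1)] that(2)] by simp
  ultimately have "coefficient_specialization R n I (x, (B, b)) J (x', (B', b')) \<phi>"
    using hom same \<phi>emb unfolding coefficient_specialization_def by auto
  moreover have "\<phi> \<in> extensional ?A" by (simp add: \<phi>_def)
  ultimately show ?thesis using \<phi>emb by blast
qed

text \<open>
  The converse of \<open>specialization_exists\<close>: every specialization arises from coherent combinations.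
\<close>

lemma specialization_coefficients:
  assumes R: "underlying_ring R" and ext: "extended_exchange_matrix R n I (B, b)"
    and sp: "coefficient_specialization R n I (x, (B, b)) J (x', (B', b')) \<phi>"
  obtains S c where "\<And>j. j \<in> J \<Longrightarrow> finite_coeffs R I (S j) (c j)"
    "\<And>j. j \<in> J \<Longrightarrow> coherent_sum n B (S j) (c j) b (b' j)"
    "\<And>p. p \<in> trop_group R I \<Longrightarrow> \<phi> (trop_emb p) = trop_emb (lin_map J S c p)"
proof -
  obtain \<theta> where \<theta>: "\<And>p. p \<in> trop_group R I \<Longrightarrow> \<phi> (trop_emb p) = trop_emb (\<theta> p)"
    "\<theta> \<in> trop_group R I \<rightarrow> trop_group R J" "R_linear R I \<theta>"
    "continuous_map (trop_topology R I) (trop_topology R J) \<theta>"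
    and same: "same_exchange_matrix n (B, b) (B', b')"
    using sp by (auto simp: coefficient_specialization_def)
  have "\<forall>j. \<exists>S c. j \<in> J \<longrightarrow> finite_coeffs R I S c \<and> (\<forall>p\<in>trop_group R I. expo (\<theta> p) j = (\<Sum>i\<in>S. c i * expo p i))"
    using continuous_linear_component[OF R \<theta>(3,2,4)] by blast
  then obtain S c where S: "\<And>j. j \<in> J \<Longrightarrow> finite_coeffs R I (S j) (c j)"
    "\<And>j p. j \<in> J \<Longrightarrow> p \<in> trop_group R I \<Longrightarrow> expo (\<theta> p) j = (\<Sum>i\<in>S j. c j i * expo p i)"
    by metis
  have eq: "\<theta> p = lin_map J S c p" if p: "p \<in> trop_group R I" for p
  proof (rule trop.expand)
    have "expo (\<theta> p) j = 0" if "j \<notin> J" for j using \<theta>(2) p that by (auto simp: trop_group_def)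
    then show "expo (\<theta> p) = expo (lin_map J S c p)"
      using S(2) p by (auto simp: lin_map_def fun_eq_iff)
  qed
  have emb: "\<phi> (trop_emb p) = trop_emb (lin_map J S c p)" if "p \<in> trop_group R I" for p
    using \<theta>(1)[OF that] eq[OF that] by simp
  have SI: "\<forall>j\<in>J. S j \<subseteq> I" using S(1) by (auto simp: finite_coeffs_def)
  have coh: "coherent_sum n B (S j) (c j) b (b' j)" if j: "j \<in> J" for j
  proof (rule coherent_sumI)
    fix t l assume t: "t \<in> tree_vertices n" and l: "l \<in> {1..n}"
    then have t': "set t \<subseteq> {1..n}" by (auto simp: tree_vertices_def)
    note Y = coeff_at_in[OF R ext t' l, of x]
    have "lin_map J S c (coeff_at n I (x, (B, b)) t l) = coeff_at n J (x', (B', b')) t l"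
      "lin_map J S c (trop_oplus (coeff_at n I (x, (B, b)) t l) 0) = trop_oplus (coeff_at n J (x', (B', b')) t l) 0"
      using sp t l emb[OF Y(1)] emb[OF Y(2)] by (auto simp: coefficient_specialization_def trop_emb_eq_iff)
    then show "(\<Sum>i\<in>S j. c j i * eta_seq B t (b i) l) = eta_seq B t (b' j) l \<and>
        (\<Sum>i\<in>S j. c j i * min (eta_seq B t (b i) l) 0) = min (eta_seq B t (b' j) l) 0"
      unfolding lin_map_coeff_at[OF same SI t' l] using j by blast
  qed
  show ?thesis by (rule that[OF S(1) coh emb])
qed

section \<open>Bases and universality\<close>

text \<open>
  Existence comes from expanding each row of the target; for uniqueness, any two specializations are given by
  expansions of the same rows, and these coincide.
\<close>

lemma basis_imp_universal:
  assumes R: "underlying_ring R" and basis: "R_basis R n B I b"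
  shows "universal TYPE('j) R n I (B, b)"
  unfolding universal_def
proof (intro allI impI)
  fix J :: "'j set" and Bt' x x'
  assume *: "extended_exchange_matrix R n J Bt' \<and> same_exchange_matrix n (B, b) Bt' \<and>
      is_seed R n I (x, (B, b)) \<and> is_seed R n J (x', Bt')"
  obtain B' b' where Bt': "Bt' = (B', b')" by (cases Bt')
  have ext: "extended_exchange_matrix R n I (B, b)" "extended_exchange_matrix R n J (B', b')"
    and same: "same_exchange_matrix n (B, b) (B', b')"
    and seeds: "is_seed R n I (x, (B, b))" "is_seed R n J (x', (B', b'))"
    using * by (auto simp: Bt' is_seed_def)
  let ?sp = "coefficient_specialization R n I (x, (B, b)) J (x', (B', b'))"
  let ?A = "cluster_algebra R n I (x, (B, b))"
  have "\<exists>S c. finite_coeffs R I S c \<and> coherent_sum n B S c b (b' j)" if j: "j \<in> J" for j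
  proof -
    have "\<forall>l\<in>{1..n}. b' j l \<in> R" using ext(2) j by (auto simp: extended_exchange_matrix_def)
    then have "\<exists>S c. finite S \<and> S \<subseteq> I \<and> (\<forall>i\<in>S. c i \<in> R) \<and>
      B_coherent n B (insert None (Some ` S)) (case_option 1 (\<lambda>i. - c i)) (case_option (b' j) b)"
      by (rule basis[unfolded R_basis_def, THEN conjunct2, THEN conjunct1, THEN spec, THEN mp])
    then show ?thesis by (metis B_coherent_minus_sum finite_coeffs_def)
  qed
  then obtain S c where S: "\<And>j. j \<in> J \<Longrightarrow> finite_coeffs R I (S j) (c j)"
    "\<And>j. j \<in> J \<Longrightarrow> coherent_sum n B (S j) (c j) b (b' j)" by metis
  obtain \<phi> where \<phi>: "\<phi> \<in> extensional ?A" "?sp \<phi>"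
    using specialization_exists[OF R seeds same S] by blast
  have "\<phi>1 = \<phi>2" if \<phi>12: "\<phi>1 \<in> extensional ?A" "?sp \<phi>1" "\<phi>2 \<in> extensional ?A" "?sp \<phi>2" for \<phi>1 \<phi>2
  proof -
    obtain S1 c1 where 1: "\<And>j. j \<in> J \<Longrightarrow> finite_coeffs R I (S1 j) (c1 j)"
      "\<And>j. j \<in> J \<Longrightarrow> coherent_sum n B (S1 j) (c1 j) b (b' j)"
      "\<And>p. p \<in> trop_group R I \<Longrightarrow> \<phi>1 (trop_emb p) = trop_emb (lin_map J S1 c1 p)"
      using specialization_coefficients[OF R ext(1) \<phi>12(2)] by blast
    obtain S2 c2 where 2: "\<And>j. j \<in> J \<Longrightarrow> finite_coeffs R I (S2 j) (c2 j)"
      "\<And>j. j \<in> J \<Longrightarrow> coherent_sum n B (S2 j) (c2 j) b (b' j)"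
      "\<And>p. p \<in> trop_group R I \<Longrightarrow> \<phi>2 (trop_emb p) = trop_emb (lin_map J S2 c2 p)"
      using specialization_coefficients[OF R ext(1) \<phi>12(4)] by blast
    have "lin_map J S1 c1 p = lin_map J S2 c2 p" for p
      unfolding lin_map_def using coherent_sum_unique[OF R basis 1(1,2) 2(1,2)] by (auto simp: fun_eq_iff)
    then show ?thesis
      using specialization_determined[OF R seeds \<phi>12(2,4,1,3)] 1(3) 2(3) by simp
  qed
  then show "\<exists>!\<phi>. \<phi> \<in> extensional ?A \<and> coefficient_specialization R n I (x, (B, b)) J (x', Bt') \<phi>"
    unfolding Bt' using \<phi> by blast
qed

text \<open>
  Targets with a single coefficient row suffice, so any one element of the index type, here
  \<open>undefined\<close>, can serve as the index set.
\<close>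

lemma universal_imp_basis:
  assumes R: "underlying_ring R" and ext: "extended_exchange_matrix R n I (B, b)"
    and univ: "universal TYPE('j) R n I (B, b)"
  shows "R_basis R n B I b"
proof -
  define J :: "'j set" where "J = {undefined}"
  have J: "undefined \<in> J" by (simp add: J_def)
  have seed: "is_seed R n I (variable, (B, b))" by (rule is_seed_variable[OF R ext])
  let ?A = "cluster_algebra R n I (variable, (B, b))"
  let ?sp = "\<lambda>a. coefficient_specialization R n I (variable, (B, b)) J (variable, (B, \<lambda>_. a))"
  have same: "same_exchange_matrix n (B, b) (B, b')" for b' :: "'j \<Rightarrow> nat \<Rightarrow> real"
    by (simp add: same_exchange_matrix_def)
  have seed': "is_seed R n J (variable, (B, \<lambda>_. a))" if "\<forall>j\<in>{1..n}. a j \<in> R" for a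
    using ext that by (intro is_seed_variable R) (auto simp: extended_exchange_matrix_def)
  have univ': "\<exists>!\<phi>. \<phi> \<in> extensional ?A \<and> ?sp a \<phi>" if "\<forall>j\<in>{1..n}. a j \<in> R" for a
    using univ seed seed'[OF that] same unfolding universal_def by (auto simp: is_seed_def)
  have spanning: "\<exists>S c. finite S \<and> S \<subseteq> I \<and> (\<forall>i\<in>S. c i \<in> R) \<and>
      B_coherent n B (insert None (Some ` S)) (case_option 1 (\<lambda>i. - c i)) (case_option a b)"
    if a: "\<forall>j\<in>{1..n}. a j \<in> R" for a
  proof -
    obtain \<phi> where "?sp a \<phi>" using univ'[OF a] by blast
    then obtain S c where "finite_coeffs R I (S undefined) (c undefined)"
      "coherent_sum n B (S undefined) (c undefined) b a"
      using specialization_coefficients[OF R ext] J by metis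
    then show ?thesis by (metis B_coherent_minus_sum finite_coeffs_def)
  qed
  have independent: "c i = 0" if S: "finite S" "S \<subseteq> I" "\<forall>i\<in>S. c i \<in> R" "B_coherent n B S c b" and i: "i \<in> S" for S c i
  proof -
    note s = is_subringD[OF underlying_ringD(1)[OF R]]
    have z: "\<forall>j\<in>{1..n}. (0::real) \<in> R" using s by blast
    \<comment> \<open>the zero row has two coherent expansions, the given relation and the empty one\<close>
    have 1: "finite_coeffs R I S c" "coherent_sum n B S c b (\<lambda>_. 0)"
      using S by (auto simp: finite_coeffs_def coherent_sum_0)
    have 2: "finite_coeffs R I {} c" "coherent_sum n B {} c b (\<lambda>_. 0)"
      by (auto simp: finite_coeffs_def coherent_sum_def eta_seq_0)
    obtain \<phi>1 where \<phi>1: "\<phi>1 \<in> extensional ?A" "?sp (\<lambda>_. 0) \<phi>1"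
      "\<forall>p\<in>trop_group R I. \<phi>1 (trop_emb p) = trop_emb (lin_map J (\<lambda>_. S) (\<lambda>_. c) p)"
      using specialization_exists[OF R seed seed'[OF z] same, of "\<lambda>_. S" "\<lambda>_. c"] 1 by blast
    obtain \<phi>2 where \<phi>2: "\<phi>2 \<in> extensional ?A" "?sp (\<lambda>_. 0) \<phi>2"
      "\<forall>p\<in>trop_group R I. \<phi>2 (trop_emb p) = trop_emb (lin_map J (\<lambda>_. {}) (\<lambda>_. c) p)"
      using specialization_exists[OF R seed seed'[OF z] same, of "\<lambda>_. {}" "\<lambda>_. c"] 2 by blast
    define e where "e = Trop (\<lambda>k. if k = i then 1 else 0)"
    have e: "e \<in> trop_group R I" using i S s by (auto simp: e_def trop_group_def)
    have "\<phi>1 = \<phi>2" using univ'[OF z] \<phi>1 \<phi>2 by blast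
    then have "lin_map J (\<lambda>_. S) (\<lambda>_. c) e = lin_map J (\<lambda>_. {}) (\<lambda>_. c) e"
      using \<phi>1(3) \<phi>2(3) e by (metis trop_emb_eq_iff)
    then have "expo (lin_map J (\<lambda>_. S) (\<lambda>_. c) e) undefined = expo (lin_map J (\<lambda>_. {}) (\<lambda>_. c) e) undefined"
      by simp
    then show "c i = 0"
      using i S(1) J by (simp add: lin_map_def e_def if_distrib[of "(*) _"] cong: if_cong)
  qed
  show ?thesis
    unfolding R_basis_def
    using ext spanning independent by (auto simp: extended_exchange_matrix_def)
qed

theorem theorem4p4:
  fixes R :: "real set" and n :: nat and I :: "'i set"
    and B :: "nat \<Rightarrow> nat \<Rightarrow> int" and b :: "'i \<Rightarrow> nat \<Rightarrow> real"
  assumes "underlying_ring R"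
    and "exchange_matrix n B"
    and "extended_exchange_matrix R n I (B, b)"
  shows "universal TYPE('j) R n I (B, b) \<longleftrightarrow> R_basis R n B I b"
  using universal_imp_basis[OF assms(1,3)] basis_imp_universal[OF assms(1)] by blast

end
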